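(* Let $V=\{1,\dots,m\}$ with $m\ge 2$, and let $\mathsf{Z}_V=(\mathsf{Z}_i\mid i\in V)$ be a hypergraphical source with hypergraph $(V,E,\xi)$ and edge variables $\mathsf{X}_e$, $e\in E$. Then $$C_{\mathrm S}(0)=J_{\mathrm{GK}}(\mathsf{Z}_V),$$ where $C_{\mathrm S}(0)$ is the secrecy capacity at asymptotically zero discussion rate and $J_{\mathrm{GK}}(\mathsf{Z}_V)$ is the multivariate Gács–Körner common information. Moreover, the random variable $$\mathsf{G}=\mathsf{X}_{\{e\in E\mid \xi(e)=V\}}:=(\mathsf{X}_e\mid e\in E,\ \xi(e)=V),$$ consisting of the edge variables observed by every user, is an optimal solution to the maximization defining $J_{\mathrm{GK}}(\mathsf{Z}_V)$.
   Context: All entropies and logarithms use the same fixed base. Source and secret key agreement. $V=\{1,\dots,m\}$, $m\ge2$, is the set of users; $\mathsf{Z}_V=(\mathsf{Z}_i\mid i\in V)$ is a tuple of random variables with joint distribution $P_{\mathsf{Z}_V}$ on a finite alphabet $\prod_{i\in V}Z_i$. A secret key agreement scheme, for each block length $n$, is as follows. Each user $i\in V$ generates a private (discrete) random variable $\mathsf{U}_i$, with $P_{\mathsf{U}_V}=\prod_{i\in V}P_{\mathsf{U}_i}$, and observes $\mathsf{Z}_i^n$, where $\mathsf{Z}_V^n$ is an i.i.d. sequence of $n$ copies of $\mathsf{Z}_V$, independent of $\mathsf{U}_V$. Write $\tilde{\mathsf{Z}}_i:=(\mathsf{U}_i,\mathsf{Z}_i^n)$. The users discuss interactively in public over multiple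 rounds: in round $t=1,2,\dots$ some user $i_t\in V$ broadcasts $\mathsf{F}_t=f_t(\mathsf{F}^{t-1},\tilde{\mathsf{Z}}_{i_t})$, where $f_t$ is a function and $\mathsf{F}^{t-1}=(\mathsf{F}_\tau\mid \tau<t)$. The whole discussion is $\mathsf{F}=(\mathsf{F}_1,\mathsf{F}_2,\dots)$, with finite alphabet $F$. A secret key $\mathsf{K}$ is a random variable with finite alphabet $K$ (all quantities depend on $n$) satisfying, for some functions $\phi_i$, $i\in V$, $$\lim_{n\to\infty}\Pr\big(\exists i\in V,\ \mathsf{K}\ne\phi_i(\mathsf{F},\tilde{\mathsf{Z}}_i)\big)=0 \quad\text{(recoverability)},$$ $$\limsup_{n\to\infty}\tfrac1n\big[\log|K|-H(\mathsf{K}\mid\mathsf{F})\big]=0\quad\text{(secrecy)}.$$ For $R\ge0$, the secrecy capacity $C_{\mathrm S}(R)$ is the supremum of $\liminf_{n\to\infty}\frac1n\log|K|$ over all such (sequences of) schemes that satisfy $\limsup_{n\to\infty}\frac1n\log|F|\le R$. Gács–Körner common information. $$J_{\mathrm{GK}}(\mathsf{Z}_V):=\max\{H(\mathsf{G})\mid H(\mathsf{G}\mid\mathsf{Z}_i)=0\ \ \forall i\in V\}.$$ Hypergraphical source. $\mathsf{Z}_V$ is hypergraphical if there are a finite edge set $E$, an edge function $\xi:E\to 2^V\setminus\{\emptyset\}$, and mutually independent random variables $\mathsf{X}_e$, $e\in E$ (edge variables), such that for every $i\in V$, $\mathsf{Z}_i$ is equivalent up to bijection to $(\mathsf{X}_e\mid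 e\in E,\ i\in\xi(e))$. Here two random variables $\mathsf{A},\mathsf{B}$ are equivalent up to bijection if $H(\mathsf{A}\mid\mathsf{B})=H(\mathsf{B}\mid\mathsf{A})=0$. *)

theory Defs
  imports "HOL-Probability.Probability" "HOL-Probability.Product_PMF"
begin

section \<open>Entropies and tuples of random variables\<close>

text \<open>
  The library has the notation for entropy and conditional entropy of discrete random variables
  only as abbreviations inside the locale \<^locale>\<open>information_space\<close>. The following are the same
  expressions with the probability space and the base made explicit.
\<close>

definition rv_entropy :: "real \<Rightarrow> 'a measure \<Rightarrow> ('a \<Rightarrow> 'x) \<Rightarrow> real" where
  "rv_entropy b M X = prob_space.entropy M b (count_space (X ` space M)) X"

definition rv_cond_entropy :: "real \<Rightarrow> 'a measure \<Rightarrow> ('a \<Rightarrow> 'x) \<Rightarrow> ('a \<Rightarrow> 'y) \<Rightarrow> real" where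
  "rv_cond_entropy b M X Y =
     prob_space.conditional_entropy M b (count_space (X ` space M)) (count_space (Y ` space M)) X Y"

definition rv_tuple :: "'i set \<Rightarrow> ('i \<Rightarrow> 'a \<Rightarrow> 'x) \<Rightarrow> 'a \<Rightarrow> ('i \<Rightarrow> 'x)" where
  "rv_tuple I X \<omega> = (\<lambda>i\<in>I. X i \<omega>)"

definition rv_equiv :: "real \<Rightarrow> 'a measure \<Rightarrow> ('a \<Rightarrow> 'x) \<Rightarrow> ('a \<Rightarrow> 'y) \<Rightarrow> bool" where
  "rv_equiv b M A B \<longleftrightarrow> rv_cond_entropy b M A B = 0 \<and> rv_cond_entropy b M B A = 0"

text \<open>Meaningful for finitely valued \<open>X\<close>; see \<open>pmf_rv_law\<close>.\<close>

definition rv_law :: "'a measure \<Rightarrow> ('a \<Rightarrow> 'x) \<Rightarrow> 'x pmf" where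
  "rv_law M X = embed_pmf (\<lambda>x. measure M (X -` {x} \<inter> space M))"

lemma pmf_rv_law:
  assumes "prob_space M" "simple_function M X"
  shows "pmf (rv_law M X) x = measure M (X -` {x} \<inter> space M)"
proof -
  interpret prob_space M by fact
  have fin: "finite (X ` space M)" and meas: "\<And>x. X -` {x} \<inter> space M \<in> sets M"
    using simple_functionD[OF assms(2)] by auto
  have zero: "measure M (X -` {x} \<inter> space M) = 0" if "x \<notin> X ` space M" for x
  proof -
    have "X -` {x} \<inter> space M = {}" using that by auto
    then show ?thesis by simp
  qed
  have "(\<integral>\<^sup>+ x. ennreal (measure M (X -` {x} \<inter> space M)) \<partial>count_space UNIV) =
      (\<Sum>x\<in>X ` space M. ennreal (measure M (X -` {x} \<inter> space M)))"
    by (subst nn_integral_count_space'[where A = "X ` space M"]) (use fin zero in auto)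
  also have "\<dots> = ennreal (\<Sum>x\<in>X ` space M. measure M (X -` {x} \<inter> space M))"
    by (simp add: sum_ennreal)
  also have "(\<Sum>x\<in>X ` space M. measure M (X -` {x} \<inter> space M)) =
      measure M (\<Union>x\<in>X ` space M. X -` {x} \<inter> space M)"
    by (rule finite_measure_finite_Union[symmetric])
      (use fin meas in \<open>auto simp: disjoint_family_on_def\<close>)
  also have "(\<Union>x\<in>X ` space M. X -` {x} \<inter> space M) = space M" by auto
  finally show ?thesis
    unfolding rv_law_def by (subst pmf_embed_pmf) (simp_all add: prob_space)
qed


section \<open>Secret key agreement\<close>

text \<open>
  A scheme for one fixed block length. Alphabets of private randomness, messages and keys are
  countable, so their elements are coded as natural numbers. A sample point \<open>(u, zs, k)\<close> consists of
  the private randomness \<open>u i\<close> of each user \<open>i\<close>, the source symbols \<open>zs t i\<close> of user \<open>i\<close> at time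
  \<open>t < n\<close>, and the key \<open>k\<close>, which is a random variable that may be correlated with the rest in an
  arbitrary way. A user's observation is the pair of its private randomness and its source block.
\<close>

type_synonym 'z sk_outcome = "(nat \<Rightarrow> nat) \<times> (nat \<Rightarrow> nat \<Rightarrow> 'z) \<times> nat"

type_synonym 'z sk_obs = "nat \<times> 'z list"

record 'z sk_scheme =
  sk_private :: "nat \<Rightarrow> nat pmf"
  sk_joint :: "'z sk_outcome pmf"
  sk_rounds :: nat
  sk_speaker :: "nat \<Rightarrow> nat"
  sk_message :: "nat \<Rightarrow> nat list \<Rightarrow> 'z sk_obs \<Rightarrow> nat"
  sk_F_alphabet :: "nat list set"
  sk_K_alphabet :: "nat set"
  sk_recover :: "nat \<Rightarrow> nat list \<Rightarrow> 'z sk_obs \<Rightarrow> nat"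

definition sk_observation :: "nat \<Rightarrow> 'z sk_outcome \<Rightarrow> nat \<Rightarrow> 'z sk_obs" where
  "sk_observation n = (\<lambda>(u, zs, k) i. (u i, map (\<lambda>t. zs t i) [0..<n]))"

definition sk_key :: "'z sk_outcome \<Rightarrow> nat" where
  "sk_key = (\<lambda>(u, zs, k). k)"

primrec sk_transcript :: "nat \<Rightarrow> 'z sk_scheme \<Rightarrow> 'z sk_outcome \<Rightarrow> nat \<Rightarrow> nat list" where
  "sk_transcript n S \<omega> 0 = []"
| "sk_transcript n S \<omega> (Suc t) =
     sk_transcript n S \<omega> t @
     [sk_message S t (sk_transcript n S \<omega> t) (sk_observation n \<omega> (sk_speaker S t))]"

definition sk_discussion :: "nat \<Rightarrow> 'z sk_scheme \<Rightarrow> 'z sk_outcome \<Rightarrow> nat list" where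
  "sk_discussion n S \<omega> = sk_transcript n S \<omega> (sk_rounds S)"

text \<open>\<open>P\<close> is the joint law of the source tuple of the users in \<open>V\<close>. The first conjunct says that the
  private random variables are mutually independent, that the source block consists of \<open>n\<close> i.i.d.
  copies of the source, and that the two are independent.\<close>

definition sk_valid :: "nat set \<Rightarrow> (nat \<Rightarrow> 'z) pmf \<Rightarrow> nat \<Rightarrow> 'z sk_scheme \<Rightarrow> bool" where
  "sk_valid V P n S \<longleftrightarrow>
     map_pmf (\<lambda>(u, zs, k). (u, zs)) (sk_joint S) =
       pair_pmf (Pi_pmf V 0 (sk_private S)) (Pi_pmf {..<n} (\<lambda>_. undefined) (\<lambda>_. P)) \<and>
     (\<forall>t<sk_rounds S. sk_speaker S t \<in> V) \<and>
     finite (sk_F_alphabet S) \<and>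
     (\<forall>\<omega>\<in>set_pmf (sk_joint S). sk_discussion n S \<omega> \<in> sk_F_alphabet S) \<and>
     finite (sk_K_alphabet S) \<and>
     (\<forall>\<omega>\<in>set_pmf (sk_joint S). sk_key \<omega> \<in> sk_K_alphabet S)"

definition sk_error :: "nat set \<Rightarrow> nat \<Rightarrow> 'z sk_scheme \<Rightarrow> real" where
  "sk_error V n S = measure_pmf.prob (sk_joint S)
     {\<omega>. \<exists>i\<in>V. sk_key \<omega> \<noteq> sk_recover S i (sk_discussion n S \<omega>) (sk_observation n \<omega> i)}"

definition sk_key_rate :: "real \<Rightarrow> nat \<Rightarrow> 'z sk_scheme \<Rightarrow> real" where
  "sk_key_rate b n S = log b (card (sk_K_alphabet S)) / n"

definition sk_discussion_rate :: "real \<Rightarrow> nat \<Rightarrow> 'z sk_scheme \<Rightarrow> real" where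
  "sk_discussion_rate b n S = log b (card (sk_F_alphabet S)) / n"

definition sk_leakage_rate :: "real \<Rightarrow> nat \<Rightarrow> 'z sk_scheme \<Rightarrow> real" where
  "sk_leakage_rate b n S =
     (log b (card (sk_K_alphabet S)) -
      rv_cond_entropy b (measure_pmf (sk_joint S)) sk_key (sk_discussion n S)) / n"

definition sk_admissible ::
    "real \<Rightarrow> nat set \<Rightarrow> (nat \<Rightarrow> 'z) pmf \<Rightarrow> real \<Rightarrow> (nat \<Rightarrow> 'z sk_scheme) \<Rightarrow> bool" where
  "sk_admissible b V P R S \<longleftrightarrow>
     (\<forall>n. sk_valid V P n (S n)) \<and>
     (\<lambda>n. sk_error V n (S n)) \<longlonglongrightarrow> 0 \<and>
     limsup (\<lambda>n. ereal (sk_leakage_rate b n (S n))) = 0 \<and>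
     limsup (\<lambda>n. ereal (sk_discussion_rate b n (S n))) \<le> ereal R"

definition secrecy_capacity ::
    "real \<Rightarrow> 'a measure \<Rightarrow> nat set \<Rightarrow> (nat \<Rightarrow> 'a \<Rightarrow> 'z) \<Rightarrow> real \<Rightarrow> ereal" where
  "secrecy_capacity b M V Z R =
     (SUP S\<in>{S. sk_admissible b V (rv_law M (rv_tuple V Z)) R S}.
        liminf (\<lambda>n. ereal (sk_key_rate b n (S n))))"


section \<open>Gacs--Koerner common information\<close>

definition gk_feasible ::
    "real \<Rightarrow> 'a measure \<Rightarrow> 'i set \<Rightarrow> ('i \<Rightarrow> 'a \<Rightarrow> 'z) \<Rightarrow> ('a \<Rightarrow> 'g) \<Rightarrow> bool" where
  "gk_feasible b M V Z G \<longleftrightarrow>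
     simple_function M G \<and> (\<forall>i\<in>V. rv_cond_entropy b M G (Z i) = 0)"

text \<open>Taking \<open>G\<close> with values in \<^typ>\<open>nat\<close> loses nothing, since \<open>G\<close> has finite range.\<close>

definition J_GK :: "real \<Rightarrow> 'a measure \<Rightarrow> 'i set \<Rightarrow> ('i \<Rightarrow> 'a \<Rightarrow> 'z) \<Rightarrow> real" where
  "J_GK b M V Z = (SUP G\<in>{G :: 'a \<Rightarrow> nat. gk_feasible b M V Z G}. rv_entropy b M G)"


section \<open>Hypergraphical sources\<close>

definition hypergraphical ::
    "real \<Rightarrow> 'a measure \<Rightarrow> 'i set \<Rightarrow> ('i \<Rightarrow> 'a \<Rightarrow> 'z) \<Rightarrow>
     'e set \<Rightarrow> ('e \<Rightarrow> 'i set) \<Rightarrow> ('e \<Rightarrow> 'a \<Rightarrow> 'x) \<Rightarrow> bool" where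
  "hypergraphical b M V Z E \<xi> X \<longleftrightarrow>
     finite E \<and>
     \<xi> \<in> E \<rightarrow> Pow V - {{}} \<and>
     (\<forall>e\<in>E. simple_function M (X e)) \<and>
     prob_space.indep_vars M (\<lambda>_. count_space UNIV) X E \<and>
     (\<forall>i\<in>V. rv_equiv b M (Z i) (rv_tuple {e\<in>E. i \<in> \<xi> e} X))"

end

theory Submission
  imports Defs
begin

text \<open>
  Write \<open>W A\<close> for the tuple of the edge blocks and private variables with index in \<open>A\<close>, so that
  \<open>H(W A)\<close> is additive in \<open>A\<close>. If the key \<open>K\<close> is (nearly) a function of \<open>(F, W A)\<close> and of \<open>(F, W B)\<close>,
  then submodularity gives \<open>H(K | F, W (A \<inter> B)) \<le> 2 H(F)\<close> (nearly), for an arbitrary random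
  variable \<open>F\<close>. Intersecting over all users leaves only the edges seen by everybody, and hence
  \<open>H(K | F) \<le> n H(G) + O(log |F|)\<close> up to Fano terms, whether or not the discussion is interactive.
  With trivial \<open>F\<close> the same argument shows that \<open>G\<close> is optimal for the common information.
  Conversely, all users know \<open>G\<close>, and the index of its \<open>n\<close>-block in the typical set is a key that
  needs no discussion.
\<close>

section \<open>Entropy of finitely supported distributions\<close>

text \<open>The indices of \<open>W\<close> form the disjoint sum \<open>V <+> E\<close>: user
  \<open>i\<close> owns its private index and the edges at \<open>i\<close>. Distinct users share no
  private index, so \<open>2 \<le> m\<close> removes all private randomness from the intersection.
  The protocol itself never enters: \<open>F\<close> need not be a function of the
  \<open>W A\<close>, and only \<open>H(F) \<le> log |F|\<close> matters, which is o(n) at rate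
  zero. The obstacle is that private variables are merely countably valued and may have infinite
  entropy, so that adding and subtracting entropies would be meaningless. They are capped at a level
  \<open>N\<close> in what the users are taken to see, while key and discussion stay untouched; the
  cap is paid for in error probability and then sent to infinity. A second gap is that the capacity
  depends only on the law of \<open>Z\<close>, whereas the edge variables live on \<open>M\<close>;
  they are rebuilt as functions of a source symbol. All entropies are translated into
  \<open>pmf_entropy\<close> of laws with finite support, where Gibbs' inequality yields the
  cardinality bound, submodularity and Fano's inequality.\<close>

definition pmf_entropy :: "real \<Rightarrow> 'a pmf \<Rightarrow> real" where
  "pmf_entropy b p = measure_pmf.expectation p (\<lambda>x. - log b (pmf p x))"

text \<open>Puts the entropies of all functions of one sample under the same integral over
  \<open>p\<close>, so that they can be compared pointwise in \<omega>.\<close>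

lemma pmf_entropy_map:
  "pmf_entropy b (map_pmf X p) = measure_pmf.expectation p (\<lambda>\<omega>. - log b (pmf (map_pmf X p) (X \<omega>)))"
  by (simp add: pmf_entropy_def)

lemma pmf_entropy_sum:
  assumes "finite (set_pmf p)"
  shows "pmf_entropy b p = (\<Sum>x\<in>set_pmf p. - (pmf p x * log b (pmf p x)))"
  unfolding pmf_entropy_def by (subst integral_measure_pmf[OF assms]) auto

lemma pmf_map_pos: "\<omega> \<in> set_pmf p \<Longrightarrow> 0 < pmf (map_pmf X p) (X \<omega>)"
  by (auto simp: pmf_positive_iff)

lemma pmf_map_comp_ge: "pmf (map_pmf X p) x \<le> pmf (map_pmf (\<lambda>\<omega>. f (X \<omega>)) p) (f x)"
  by (auto simp: pmf_map intro!: measure_pmf.finite_measure_mono)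

lemma sum_pmf_map_pair:
  assumes "finite (set_pmf p)"
  shows "(\<Sum>x\<in>X ` set_pmf p. pmf (map_pmf (\<lambda>\<omega>. (X \<omega>, Y \<omega>)) p) (x, y)) = pmf (map_pmf Y p) y"
proof -
  have "(\<Sum>x\<in>X ` set_pmf p. pmf (map_pmf (\<lambda>\<omega>. (X \<omega>, Y \<omega>)) p) (x, y)) =
      measure p (\<Union>x\<in>X ` set_pmf p. (\<lambda>\<omega>. (X \<omega>, Y \<omega>)) -` {(x, y)})"
    unfolding pmf_map using assms
    by (intro measure_pmf.finite_measure_finite_Union[symmetric]) (auto simp: disjoint_family_on_def)
  also have "\<dots> = measure p (Y -` {y})"
    by (rule measure_prob_cong_0) (auto simp: set_pmf_eq)
  finally show ?thesis by (simp add: pmf_map)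
qed

lemma pmf_entropy_pair_pmf:
  assumes "finite (set_pmf p)" "finite (set_pmf q)" 
  shows "pmf_entropy b (pair_pmf p q) = pmf_entropy b p + pmf_entropy b q"
proof -
  have [simp]: "integrable (pair_pmf p q) f" for f :: "_ \<Rightarrow> real"
    using assms by (intro integrable_measure_pmf_finite) auto
  have "pmf_entropy b (pair_pmf p q) =
      measure_pmf.expectation (pair_pmf p q) (\<lambda>z. - log b (pmf p (fst z)) + - log b (pmf q (snd z)))"
    unfolding pmf_entropy_def
    by (intro integral_cong_AE)
      (auto simp: AE_measure_pmf_iff pmf_pair log_mult_pos pmf_positive_iff)
  also have "\<dots> = measure_pmf.expectation (pair_pmf p q) (\<lambda>z. - log b (pmf p (fst z)))
      + measure_pmf.expectation (pair_pmf p q) (\<lambda>z. - log b (pmf q (snd z)))"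
    by (subst Bochner_Integration.integral_add) auto
  also have "measure_pmf.expectation (pair_pmf p q) (\<lambda>z. - log b (pmf p (fst z))) =
      measure_pmf.expectation (map_pmf fst (pair_pmf p q)) (\<lambda>x. - log b (pmf p x))"
    by (simp only: integral_map_pmf)
  also have "measure_pmf.expectation (pair_pmf p q) (\<lambda>z. - log b (pmf q (snd z))) =
      measure_pmf.expectation (map_pmf snd (pair_pmf p q)) (\<lambda>x. - log b (pmf q x))"
    by (simp only: integral_map_pmf)
  finally show ?thesis by (simp add: map_fst_pair_pmf map_snd_pair_pmf pmf_entropy_def)
qed

lemma pmf_entropy_map_inj:
  assumes "inj_on X (set_pmf p)"
  shows "pmf_entropy b (map_pmf X p) = pmf_entropy b p"
  unfolding pmf_entropy_map unfolding pmf_entropy_def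
  by (intro integral_cong_AE) (auto simp: AE_measure_pmf_iff pmf_map_inj[OF assms])

lemma finite_set_Pi_pmf:
  assumes "finite A" "\<And>x. x \<in> A \<Longrightarrow> finite (set_pmf (p x))"
  shows "finite (set_pmf (Pi_pmf A d p))"
  using assms by (auto simp: set_Pi_pmf)

lemma pmf_entropy_Pi_pmf:
  assumes "finite A" "\<And>x. x \<in> A \<Longrightarrow> finite (set_pmf (p x))"
  shows "pmf_entropy b (Pi_pmf A d p) = (\<Sum>x\<in>A. pmf_entropy b (p x))"
  using assms
proof (induction A rule: finite_induct)
  case empty
  show ?case by (simp add: pmf_entropy_def)
next
  case (insert x A)
  \<comment> \<open>On the support \<open>f\<close> takes the default \<open>d\<close> at
    \<open>x\<close>, so overwriting that value loses nothing.\<close>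
  have inj: "inj_on (\<lambda>(y, f). f(x := y)) (set_pmf (pair_pmf (p x) (Pi_pmf A d p)))"
  proof (rule inj_onI, clarsimp)
    fix y f y' f' assume f: "f \<in> set_pmf (Pi_pmf A d p)" "f' \<in> set_pmf (Pi_pmf A d p)"
      and eq: "f(x := y) = f'(x := y')"
    then have "f x = d" "f' x = d"
      using insert.hyps by (auto simp: set_Pi_pmf PiE_dflt_def)
    then have "f z = f' z" for z using fun_cong[OF eq, of z] by (cases "z = x") auto
    then show "y = y' \<and> f = f'" using fun_cong[OF eq, of x] by auto
  qed
  show ?case
    using insert
    by (simp add: Pi_pmf_insert pmf_entropy_map_inj[OF inj] pmf_entropy_pair_pmf finite_set_Pi_pmf)
qed

section \<open>Gibbs' inequality and its consequences\<close>

context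
  fixes b :: real
  assumes b: "1 < b"
begin

text \<open>Gibbs' inequality, from \<open>ln t \<le> t - 1\<close>. The weights \<open>s\<close>
  need only have mass at most 1 on the support of \<open>p\<close>, so an entropy bound reduces to
  choosing \<open>s\<close>: uniform weights give the cardinality bound, conditionally independent
  ones submodularity, and a guess mixed with uniform weights Fano's inequality.\<close>

lemma pmf_entropy_le_cross_entropy:
  assumes "finite (set_pmf p)"
    and pos: "\<And>x. x \<in> set_pmf p \<Longrightarrow> 0 < s x" and le: "(\<Sum>x\<in>set_pmf p. s x) \<le> 1"
  shows "pmf_entropy b p \<le> measure_pmf.expectation p (\<lambda>x. - log b (s x))"
proof -
  have "pmf_entropy b p - measure_pmf.expectation p (\<lambda>x. - log b (s x)) =
      (\<Sum>x\<in>set_pmf p. pmf p x * (log b (s x) - log b (pmf p x)))"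
    unfolding pmf_entropy_sum[OF assms(1)]
    by (subst integral_measure_pmf[OF assms(1)])
      (auto simp: algebra_simps sum_subtractf sum.distrib sum_negf)
  also have "\<dots> \<le> (\<Sum>x\<in>set_pmf p. (s x - pmf p x) / ln b)"
  proof (rule sum_mono)
    fix x assume x: "x \<in> set_pmf p"
    have p: "0 < pmf p x" using x by (simp add: pmf_positive_iff)
    have "log b (s x) - log b (pmf p x) = ln (s x / pmf p x) / ln b"
      using pos[OF x] p by (simp add: log_def ln_div diff_divide_distrib)
    also have "\<dots> \<le> (s x / pmf p x - 1) / ln b"
      using pos[OF x] p b by (intro divide_right_mono ln_le_minus_one) auto
    finally have "pmf p x * (log b (s x) - log b (pmf p x)) \<le> pmf p x * ((s x / pmf p x - 1) / ln b)"
      using p by (intro mult_left_mono) auto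
    also have "\<dots> = (s x - pmf p x) / ln b" using p b by (simp add: field_simps)
    finally show "pmf p x * (log b (s x) - log b (pmf p x)) \<le> (s x - pmf p x) / ln b" .
  qed
  also have "\<dots> = ((\<Sum>x\<in>set_pmf p. s x) - (\<Sum>x\<in>set_pmf p. pmf p x)) / ln b"
    by (simp add: sum_subtractf sum_divide_distrib[symmetric])
  also have "\<dots> \<le> 0"
    using le b sum_pmf_eq_1[OF assms(1)] by (simp add: divide_nonpos_pos)
  finally show ?thesis by simp
qed

lemma neg_log_pmf_nonneg: "0 \<le> - log b (pmf p x)"
proof (cases "pmf p x = 0")
  case True
  then show ?thesis by (simp add: log_def)
next
  case False
  then have "0 < pmf p x" by (simp add: pmf_positive_iff set_pmf_eq)
  then show ?thesis using b pmf_le_1[of p x] by (subst neg_0_le_iff_le, subst log_le_zero_cancel_iff)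
qed

lemma pmf_entropy_nonneg: "0 \<le> pmf_entropy b p"
  unfolding pmf_entropy_def by (intro integral_nonneg_AE AE_I2) (rule neg_log_pmf_nonneg)

lemma pmf_entropy_le_card:
  assumes "finite A" "set_pmf p \<subseteq> A"
  shows "pmf_entropy b p \<le> log b (card A)"
proof -
  have fin: "finite (set_pmf p)" using assms finite_subset by auto
  have "card A > 0" using assms set_pmf_not_empty[of p] by (auto simp: card_gt_0_iff)
  then have "pmf_entropy b p \<le> measure_pmf.expectation p (\<lambda>x. - log b (1 / card A))"
    using card_mono[OF assms] fin
    by (intro pmf_entropy_le_cross_entropy) (auto simp: field_simps)
  also have "\<dots> = log b (card A)"
    using \<open>card A > 0\<close> by (simp add: log_divide_pos)
  finally show ?thesis .
qed

context
  fixes p :: "'a pmf"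
  assumes fin: "finite (set_pmf p)"
begin

text \<open>The fibres of \<open>X\<close> lie inside those of \<open>f\<close> after
  \<open>X\<close>, so the information content can only drop, at every sample point.\<close>

lemma pmf_entropy_map_mono:
  "pmf_entropy b (map_pmf (\<lambda>\<omega>. f (X \<omega>)) p) \<le> pmf_entropy b (map_pmf X p)"
  unfolding pmf_entropy_map
  by (intro integral_mono_AE integrable_measure_pmf_finite fin)
    (auto simp: AE_measure_pmf_iff intro!: log_mono[OF b] pmf_map_comp_ge pmf_map_pos)

text \<open>Nonnegativity of the conditional mutual information \<open>I(X; Y | Z)\<close>, obtained
  by comparing the joint law with the one that makes \<open>X\<close> and \<open>Y\<close>
  independent given \<open>Z\<close>.\<close>

lemma pmf_entropy_submodular:
  "pmf_entropy b (map_pmf (\<lambda>\<omega>. (X \<omega>, Y \<omega>, Z \<omega>)) p) + pmf_entropy b (map_pmf Z p) \<le>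
   pmf_entropy b (map_pmf (\<lambda>\<omega>. (X \<omega>, Z \<omega>)) p) + pmf_entropy b (map_pmf (\<lambda>\<omega>. (Y \<omega>, Z \<omega>)) p)"
proof -
  define pz where "pz = pmf (map_pmf Z p)"
  define pxz where "pxz = pmf (map_pmf (\<lambda>\<omega>. (X \<omega>, Z \<omega>)) p)"
  define pyz where "pyz = pmf (map_pmf (\<lambda>\<omega>. (Y \<omega>, Z \<omega>)) p)"
  \<comment> \<open>The law with the same \<open>(X, Z)\<close> and \<open>(Y, Z)\<close> marginals
    under which \<open>X\<close> and \<open>Y\<close> are conditionally independent given
    \<open>Z\<close>.\<close>
  define s where "s = (\<lambda>(x, y, z). pxz (x, z) * pyz (y, z) / pz z)"
  let ?S = "set_pmf p"
  have pos: "0 < pz (Z \<omega>)" "0 < pxz (X \<omega>, Z \<omega>)" "0 < pyz (Y \<omega>, Z \<omega>)" if "\<omega> \<in> ?S" for \<omega>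
    unfolding pz_def pxz_def pyz_def by (rule pmf_map_pos[OF that])+
  have nonneg: "0 \<le> s v" for v
    by (auto simp: s_def pz_def pxz_def pyz_def split: prod.split)
  have fin': "finite (set_pmf (map_pmf (\<lambda>\<omega>. (X \<omega>, Y \<omega>, Z \<omega>)) p))" using fin by simp
  \<comment> \<open>Enlarging the support to a product lets the sum over \<open>x\<close> and
    \<open>y\<close> factor for each \<open>z\<close>; both factors are \<open>pz z\<close>, so the
    total is 1.\<close>
  have "(\<Sum>v\<in>set_pmf (map_pmf (\<lambda>\<omega>. (X \<omega>, Y \<omega>, Z \<omega>)) p). s v) \<le> (\<Sum>v\<in>X ` ?S \<times> Y ` ?S \<times> Z ` ?S. s v)"
    by (rule sum_mono2) (use fin nonneg in auto)
  also have "\<dots> = (\<Sum>z\<in>Z ` ?S. (\<Sum>x\<in>X ` ?S. pxz (x, z)) * (\<Sum>y\<in>Y ` ?S. pyz (y, z)) / pz z)"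
  proof -
    have "(\<Sum>v\<in>X ` ?S \<times> Y ` ?S \<times> Z ` ?S. s v) =
        (\<Sum>x\<in>X ` ?S. \<Sum>y\<in>Y ` ?S. \<Sum>z\<in>Z ` ?S. pxz (x, z) * pyz (y, z) / pz z)"
      by (simp add: s_def sum.cartesian_product)
    also have "\<dots> = (\<Sum>x\<in>X ` ?S. \<Sum>z\<in>Z ` ?S. \<Sum>y\<in>Y ` ?S. pxz (x, z) * pyz (y, z) / pz z)"
      by (rule sum.cong[OF refl], rule sum.swap)
    also have "\<dots> = (\<Sum>z\<in>Z ` ?S. \<Sum>x\<in>X ` ?S. \<Sum>y\<in>Y ` ?S. pxz (x, z) * pyz (y, z) / pz z)"
      by (rule sum.swap)
    also have "\<dots> = (\<Sum>z\<in>Z ` ?S. (\<Sum>x\<in>X ` ?S. pxz (x, z)) * (\<Sum>y\<in>Y ` ?S. pyz (y, z)) / pz z)"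
      by (simp only: sum_product sum_divide_distrib)
    finally show ?thesis .
  qed
  also have "\<dots> = (\<Sum>z\<in>Z ` ?S. pz z)"
    by (rule sum.cong) (auto simp: pxz_def pyz_def pz_def sum_pmf_map_pair[OF fin])
  also have "\<dots> = 1"
    unfolding pz_def by (rule sum_pmf_eq_1) (use fin in auto)
  finally have "pmf_entropy b (map_pmf (\<lambda>\<omega>. (X \<omega>, Y \<omega>, Z \<omega>)) p) \<le>
      measure_pmf.expectation (map_pmf (\<lambda>\<omega>. (X \<omega>, Y \<omega>, Z \<omega>)) p) (\<lambda>v. - log b (s v))"
    by (intro pmf_entropy_le_cross_entropy fin') (auto simp: s_def pos)
  also have "\<dots> = measure_pmf.expectation p
      (\<lambda>\<omega>. - log b (pxz (X \<omega>, Z \<omega>)) + - log b (pyz (Y \<omega>, Z \<omega>)) - - log b (pz (Z \<omega>)))"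
    unfolding integral_map_pmf
    by (intro integral_cong_AE)
      (auto simp: AE_measure_pmf_iff s_def log_mult_pos log_divide_pos pos)
  also have "\<dots> = pmf_entropy b (map_pmf (\<lambda>\<omega>. (X \<omega>, Z \<omega>)) p)
      + pmf_entropy b (map_pmf (\<lambda>\<omega>. (Y \<omega>, Z \<omega>)) p) - pmf_entropy b (map_pmf Z p)"
    unfolding pmf_entropy_map pz_def pxz_def pyz_def
    by (simp add: Bochner_Integration.integral_add Bochner_Integration.integral_diff integrable_measure_pmf_finite fin)
  finally show ?thesis by simp
qed

lemma pmf_entropy_pair_le:
  "pmf_entropy b (map_pmf (\<lambda>\<omega>. (X \<omega>, Y \<omega>)) p) \<le> pmf_entropy b (map_pmf X p) + pmf_entropy b (map_pmf Y p)"
proof -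
  have "pmf_entropy b (map_pmf (\<lambda>\<omega>. (X \<omega>, Y \<omega>)) p) \<le>
      pmf_entropy b (map_pmf (\<lambda>\<omega>. (X \<omega>, Y \<omega>, ())) p)"
    using pmf_entropy_map_mono[of "\<lambda>(x, y, _). (x, y)" "\<lambda>\<omega>. (X \<omega>, Y \<omega>, ())"] by simp
  also have "\<dots> \<le> pmf_entropy b (map_pmf (\<lambda>\<omega>. (X \<omega>, ())) p)
      + pmf_entropy b (map_pmf (\<lambda>\<omega>. (Y \<omega>, ())) p)"
    using pmf_entropy_submodular[of X Y "\<lambda>_. ()"] pmf_entropy_nonneg[of "map_pmf (\<lambda>_. ()) p"] by simp
  also have "\<dots> \<le> pmf_entropy b (map_pmf X p) + pmf_entropy b (map_pmf Y p)"
    using pmf_entropy_map_mono[of "\<lambda>x. (x, ())" X] pmf_entropy_map_mono[of "\<lambda>x. (x, ())" Y] by simp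
  finally show ?thesis .
qed

text \<open>Fano's inequality with \<open>log b 2\<close> in place of the binary entropy of the
  error. This form is monotone in \<epsilon>, so any upper bound on the error probability can be
  inserted.\<close>

lemma pmf_entropy_fano:
  assumes A: "finite A" "X ` set_pmf p \<subseteq> A" and \<epsilon>: "measure_pmf.prob p {\<omega>. X \<omega> \<noteq> \<phi> (Y \<omega>)} \<le> \<epsilon>"
  shows "pmf_entropy b (map_pmf (\<lambda>\<omega>. (X \<omega>, Y \<omega>)) p) - pmf_entropy b (map_pmf Y p)
    \<le> log b 2 + \<epsilon> * log b (card A)"
proof -
  \<comment> \<open>Given \<open>y\<close>, half of the mass sits on the guess and the other half is
    spread uniformly over \<open>A\<close>. A correct guess then costs \<open>log b 2\<close>, a
    wrong one \<open>log b (card A)\<close> more.\<close>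
  define r where "r = (\<lambda>x y. if x = \<phi> y then 1 / 2 else 1 / (2 * real (card A)))"
  define py where "py = pmf (map_pmf Y p)"
  define s where "s = (\<lambda>(x, y). py y * r x y)"
  let ?S = "set_pmf p"
  have card: "card A > 0" using A set_pmf_not_empty[of p] by (auto simp: card_gt_0_iff)
  have pos: "0 < py (Y \<omega>)" if "\<omega> \<in> ?S" for \<omega>
    unfolding py_def by (rule pmf_map_pos[OF that])
  have r_pos: "0 < r x y" for x y using card by (auto simp: r_def)
  have r_sum: "(\<Sum>x\<in>A. r x y) \<le> 1" for y
  proof -
    have "(\<Sum>x\<in>A. r x y) \<le> (\<Sum>x\<in>A. (if x = \<phi> y then 1 / 2 else 0) + 1 / (2 * real (card A)))"
      by (rule sum_mono) (auto simp: r_def)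
    also have "\<dots> \<le> 1 / 2 + 1 / 2"
      using A card by (auto simp: sum.distrib sum.delta)
    finally show ?thesis by simp
  qed
  have fin': "finite (set_pmf (map_pmf (\<lambda>\<omega>. (X \<omega>, Y \<omega>)) p))" using fin by simp
  have "(\<Sum>v\<in>set_pmf (map_pmf (\<lambda>\<omega>. (X \<omega>, Y \<omega>)) p). s v) \<le> (\<Sum>v\<in>A \<times> Y ` ?S. s v)"
    by (rule sum_mono2) (use fin A r_pos in \<open>auto simp: s_def py_def less_imp_le\<close>)
  also have "\<dots> = (\<Sum>y\<in>Y ` ?S. py y * (\<Sum>x\<in>A. r x y))"
    unfolding s_def sum.cartesian_product[symmetric]
    by (subst sum.swap) (simp add: sum_distrib_left)
  also have "\<dots> \<le> (\<Sum>y\<in>Y ` ?S. py y)"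
    using r_sum by (intro sum_mono mult_left_le) (auto simp: py_def)
  also have "\<dots> = 1"
    unfolding py_def by (rule sum_pmf_eq_1) (use fin in auto)
  finally have "pmf_entropy b (map_pmf (\<lambda>\<omega>. (X \<omega>, Y \<omega>)) p) \<le>
      measure_pmf.expectation (map_pmf (\<lambda>\<omega>. (X \<omega>, Y \<omega>)) p) (\<lambda>v. - log b (s v))"
    by (intro pmf_entropy_le_cross_entropy fin') (auto simp: s_def pos r_pos)
  also have "\<dots> = measure_pmf.expectation p (\<lambda>\<omega>. - log b (py (Y \<omega>)) + (log b 2
      + log b (card A) * indicator {\<omega>. X \<omega> \<noteq> \<phi> (Y \<omega>)} \<omega>))"
    unfolding integral_map_pmf
  proof (intro integral_cong_AE)
    show "AE \<omega> in p. - log b (s (X \<omega>, Y \<omega>)) = - log b (py (Y \<omega>)) + (log b 2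
      + log b (card A) * indicator {\<omega>. X \<omega> \<noteq> \<phi> (Y \<omega>)} \<omega>)"
    proof (rule AE_pmfI)
      fix \<omega> assume \<omega>: "\<omega> \<in> ?S"
      have "log b (r (X \<omega>) (Y \<omega>)) = - (log b 2 + log b (card A) * indicator {\<omega>. X \<omega> \<noteq> \<phi> (Y \<omega>)} \<omega>)"
        using card by (auto simp: r_def log_divide_pos log_mult_pos)
      then show "- log b (s (X \<omega>, Y \<omega>)) = - log b (py (Y \<omega>)) + (log b 2
          + log b (card A) * indicator {\<omega>. X \<omega> \<noteq> \<phi> (Y \<omega>)} \<omega>)"
        using pos[OF \<omega>] r_pos[of "X \<omega>" "Y \<omega>"] by (simp add: s_def log_mult_pos)
    qed
  qed auto
  also have "\<dots> = pmf_entropy b (map_pmf Y p) + (log b 2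
      + log b (card A) * measure_pmf.prob p {\<omega>. X \<omega> \<noteq> \<phi> (Y \<omega>)})"
    unfolding pmf_entropy_map py_def
    by (simp add: Bochner_Integration.integral_add integrable_measure_pmf_finite fin)
  also have "\<dots> \<le> pmf_entropy b (map_pmf Y p) + (log b 2 + log b (card A) * \<epsilon>)"
    using card b \<epsilon> by (intro add_left_mono mult_left_mono) auto
  finally show ?thesis by (simp add: mult.commute)
qed

text \<open>Turns vanishing conditional entropy into functional dependence. The entropy difference
  is an average of nonnegative terms, so equality forces \<open>(X, Y)\<close> and \<open>Y\<close>
  to have the same mass at each support point.\<close>

lemma pmf_entropy_pair_eq_iff:
  "pmf_entropy b (map_pmf (\<lambda>\<omega>. (X \<omega>, Y \<omega>)) p) = pmf_entropy b (map_pmf Y p) \<longleftrightarrow>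
   (\<exists>f. \<forall>\<omega>\<in>set_pmf p. X \<omega> = f (Y \<omega>))" (is "?l = ?r \<longleftrightarrow> _")
proof
  assume "\<exists>f. \<forall>\<omega>\<in>set_pmf p. X \<omega> = f (Y \<omega>)"
  then obtain f where f: "\<And>\<omega>. \<omega> \<in> set_pmf p \<Longrightarrow> X \<omega> = f (Y \<omega>)" by auto
  then have "map_pmf (\<lambda>\<omega>. (X \<omega>, Y \<omega>)) p = map_pmf (\<lambda>\<omega>. (\<lambda>y. (f y, y)) (Y \<omega>)) p"
    by (intro map_pmf_cong) auto
  then have "?l \<le> ?r" using pmf_entropy_map_mono[of "\<lambda>y. (f y, y)" Y] by simp
  moreover have "?r \<le> ?l" using pmf_entropy_map_mono[of snd "\<lambda>\<omega>. (X \<omega>, Y \<omega>)"] by simp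
  ultimately show "?l = ?r" by simp
next
  assume eq: "?l = ?r"
  let ?py = "\<lambda>\<omega>. pmf (map_pmf Y p) (Y \<omega>)" and ?pxy = "\<lambda>\<omega>. pmf (map_pmf (\<lambda>\<omega>. (X \<omega>, Y \<omega>)) p) (X \<omega>, Y \<omega>)"
  have le: "?pxy \<omega> \<le> ?py \<omega>" for \<omega>
    using pmf_map_comp_ge[of "\<lambda>\<omega>. (X \<omega>, Y \<omega>)" p "(X \<omega>, Y \<omega>)" snd] by simp
  have "(\<Sum>\<omega>\<in>set_pmf p. pmf p \<omega> * (log b (?py \<omega>) - log b (?pxy \<omega>))) = 0"
    using eq unfolding pmf_entropy_map
    by (subst (asm) (1 2) integral_measure_pmf[OF fin])
      (auto simp: algebra_simps sum_subtractf sum_negf)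
  then have 0: "pmf p \<omega> * (log b (?py \<omega>) - log b (?pxy \<omega>)) = 0" if "\<omega> \<in> set_pmf p" for \<omega>
    by (subst (asm) sum_nonneg_eq_0_iff[OF fin])
      (use that le in \<open>auto intro!: mult_nonneg_nonneg log_mono[OF b] pmf_map_pos\<close>)
  have eq': "?py \<omega> = ?pxy \<omega>" if "\<omega> \<in> set_pmf p" for \<omega>
  proof -
    have "log b (?py \<omega>) = log b (?pxy \<omega>)" using 0[OF that] that by (simp add: set_pmf_eq)
    moreover have "0 < ?py \<omega>" "0 < ?pxy \<omega>" using that by (auto intro!: pmf_map_pos)
    ultimately show ?thesis using inj_onD[OF log_inj[OF b]] by blast
  qed
  \<comment> \<open>Two values of \<open>X\<close> over the same \<open>y\<close> would each carry
    the full mass of \<open>y\<close>, although their masses add up to at most that.\<close>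
  have X_eq: "X \<omega> = X \<omega>'" if \<omega>: "\<omega> \<in> set_pmf p" "\<omega>' \<in> set_pmf p" "Y \<omega> = Y \<omega>'" for \<omega> \<omega>'
  proof (rule ccontr)
    assume neq: "X \<omega> \<noteq> X \<omega>'"
    have "?pxy \<omega> + ?pxy \<omega>' = (\<Sum>x\<in>{X \<omega>, X \<omega>'}. pmf (map_pmf (\<lambda>\<omega>. (X \<omega>, Y \<omega>)) p) (x, Y \<omega>))"
      using neq \<omega> by simp
    also have "\<dots> \<le> (\<Sum>x\<in>X ` set_pmf p. pmf (map_pmf (\<lambda>\<omega>. (X \<omega>, Y \<omega>)) p) (x, Y \<omega>))"
      using \<omega> fin by (intro sum_mono2) auto
    also have "\<dots> = ?py \<omega>" by (rule sum_pmf_map_pair[OF fin])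
    finally have "?pxy \<omega>' \<le> 0" using eq'[OF \<omega>(1)] by simp
    then show False using pmf_map_pos[OF \<omega>(2), of "\<lambda>\<omega>. (X \<omega>, Y \<omega>)"] by simp
  qed
  show "\<exists>f. \<forall>\<omega>\<in>set_pmf p. X \<omega> = f (Y \<omega>)"
  proof (intro exI ballI)
    fix \<omega> assume \<omega>: "\<omega> \<in> set_pmf p"
    have Y: "(SOME \<omega>'. \<omega>' \<in> set_pmf p \<and> Y \<omega>' = Y \<omega>) \<in> set_pmf p \<and>
        Y (SOME \<omega>'. \<omega>' \<in> set_pmf p \<and> Y \<omega>' = Y \<omega>) = Y \<omega>"
      by (rule someI[of _ \<omega>]) (use \<omega> in auto)
    show "X \<omega> = (\<lambda>y. X (SOME \<omega>'. \<omega>' \<in> set_pmf p \<and> Y \<omega>' = y)) (Y \<omega>)"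
      by (rule X_eq[OF \<omega>]) (use Y in simp_all)
  qed
qed

end

end

section \<open>Laws of simple random variables\<close>

context prob_space
begin

lemma set_rv_law_subset:
  assumes X: "simple_function M X"
  shows "set_pmf (rv_law M X) \<subseteq> X ` space M"
proof
  fix x assume "x \<in> set_pmf (rv_law M X)"
  then have "prob (X -` {x} \<inter> space M) \<noteq> 0"
    by (simp add: set_pmf_eq pmf_rv_law[OF prob_space_axioms X])
  then have "X -` {x} \<inter> space M \<noteq> {}" by (metis measure_empty)
  then show "x \<in> X ` space M" by auto
qed

lemma distr_eq_rv_law:
  assumes X: "simple_function M X"
  shows "distr M (count_space UNIV) X = measure_pmf (rv_law M X)"
proof -
  have meas: "X \<in> measurable M (count_space UNIV)" using X by (rule measurable_simple_function)
  have eq: "emeasure (distr M (count_space UNIV) X) {x} = emeasure (measure_pmf (rv_law M X)) {x}" for x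
    using meas by (simp add: emeasure_distr emeasure_eq_measure emeasure_pmf_single pmf_rv_law[OF prob_space_axioms X])
  show ?thesis
  proof (rule measure_eqI_countable_AE[where \<Omega> = "X ` space M"])
    show "AE x in distr M (count_space UNIV) X. x \<in> X ` space M"
      using meas by (subst AE_distr_iff) auto
    show "AE x in measure_pmf (rv_law M X). x \<in> X ` space M"
      using set_rv_law_subset[OF X] by (auto simp: AE_measure_pmf_iff)
  qed (use X eq in \<open>auto simp: simple_function_def countable_finite\<close>)
qed

lemma finite_set_rv_law:
  assumes X: "simple_function M X"
  shows "finite (set_pmf (rv_law M X))"
  using set_rv_law_subset[OF X] by (rule finite_subset) (use X in \<open>simp add: simple_function_def\<close>)

text \<open>Converts almost sure statements on \<open>M\<close> into statements about every point of
  a finite support, which is where the entropy lemmas work.\<close>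

lemma AE_rv_law_iff:
  assumes X: "simple_function M X"
  shows "(AE \<omega> in M. P (X \<omega>)) \<longleftrightarrow> (\<forall>x\<in>set_pmf (rv_law M X). P x)"
proof -
  have "(AE \<omega> in M. P (X \<omega>)) \<longleftrightarrow> (AE x in distr M (count_space UNIV) X. P x)"
    by (subst AE_distr_iff) (use X in \<open>auto intro: measurable_simple_function\<close>)
  then show ?thesis unfolding distr_eq_rv_law[OF X] by (simp add: AE_measure_pmf_iff)
qed

lemma rv_law_comp:
  assumes X: "simple_function M X"
  shows "rv_law M (\<lambda>\<omega>. f (X \<omega>)) = map_pmf f (rv_law M X)"
proof -
  have "simple_function M (\<lambda>\<omega>. f (X \<omega>))"
    using simple_function_compose[OF X, of f] by (simp add: comp_def)
  then have "measure_pmf (rv_law M (\<lambda>\<omega>. f (X \<omega>))) = distr M (count_space UNIV) (\<lambda>\<omega>. f (X \<omega>))"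
    by (simp add: distr_eq_rv_law)
  also have "\<dots> = distr (distr M (count_space UNIV) X) (count_space UNIV) f"
    by (subst distr_distr) (use X in \<open>auto simp: comp_def intro: measurable_simple_function\<close>)
  also have "\<dots> = measure_pmf (map_pmf f (rv_law M X))"
    by (simp add: distr_eq_rv_law[OF X] map_pmf_rep_eq)
  finally show ?thesis by (simp add: measure_pmf_inject)
qed

lemma rv_law_cong_AE:
  assumes X: "simple_function M X" and Y: "simple_function M Y" and eq: "AE \<omega> in M. X \<omega> = Y \<omega>"
  shows "rv_law M X = rv_law M Y"
proof -
  have XY: "simple_function M (\<lambda>\<omega>. (X \<omega>, Y \<omega>))" using X Y by (rule simple_function_Pair)
  have "rv_law M X = map_pmf fst (rv_law M (\<lambda>\<omega>. (X \<omega>, Y \<omega>)))"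
    using rv_law_comp[OF XY, of fst] by simp
  \<comment> \<open>The joint law is supported on the diagonal, so its two projections
    coincide.\<close>
  also have "\<dots> = map_pmf snd (rv_law M (\<lambda>\<omega>. (X \<omega>, Y \<omega>)))"
    using AE_rv_law_iff[OF XY, of "\<lambda>(x, y). x = y"] eq by (intro map_pmf_cong) auto
  also have "\<dots> = rv_law M Y" using rv_law_comp[OF XY, of snd] by simp
  finally show ?thesis .
qed

section \<open>Entropies over counting measures as finite sums\<close>

lemma distributed_count_space_pmf:
  assumes A: "countable A" and X: "X \<in> measurable M (count_space A)"
    and D: "\<And>x. x \<in> A \<Longrightarrow> prob (X -` {x} \<inter> space M) = pmf D x"
  shows "distributed M (count_space A) X (\<lambda>x. ennreal (pmf D x))"
  unfolding distributed_def
proof (intro conjI X)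
  show "distr M (count_space A) X = density (count_space A) (\<lambda>x. ennreal (pmf D x))"
  proof (rule measure_eqI_countable[OF _ _ A])
    fix x assume x: "x \<in> A"
    have "emeasure (density (count_space A) (\<lambda>x. ennreal (pmf D x))) {x} = ennreal (pmf D x)"
      using x by (subst emeasure_density) (auto simp: nn_integral_count_space_indicator)
    then show "emeasure (distr M (count_space A) X) {x} = emeasure (density (count_space A) (\<lambda>x. ennreal (pmf D x))) {x}"
      using X x by (simp add: emeasure_distr emeasure_eq_measure D)
  qed auto
qed simp

text \<open>\<open>A\<close> may be infinite as long as the law \<open>D\<close> has finite support,
  and \<open>D\<close> is a parameter. Both are needed to serve simple functions on \<open>M\<close>
  as well as keys and discussions, whose images of the whole outcome type can be infinite.\<close>

lemma entropy_count_space_pmf: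
  assumes b: "1 < b" and A: "countable A" and X: "X \<in> measurable M (count_space A)"
    and D: "\<And>x. x \<in> A \<Longrightarrow> prob (X -` {x} \<inter> space M) = pmf D x"
    and fin: "finite (set_pmf D)" "set_pmf D \<subseteq> A"
  shows "entropy b (count_space A) X = pmf_entropy b D"
proof -
  interpret information_space M b using b by unfold_locales
  have "entropy b (count_space A) X = - (\<integral>x. pmf D x * log b (pmf D x) \<partial>count_space A)"
    by (rule entropy_distr[OF distributed_count_space_pmf[OF A X D]]) auto
  also have "(\<integral>x. pmf D x * log b (pmf D x) \<partial>count_space A) = (\<Sum>x\<in>set_pmf D. pmf D x * log b (pmf D x))"
    using fin by (subst lebesgue_integral_count_space_finite_support)
      (auto intro!: sum.mono_neutral_left simp: set_pmf_eq elim: finite_subset[rotated])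
  finally show ?thesis by (simp add: pmf_entropy_sum[OF fin(1)] sum_negf)
qed

lemma rv_entropy_eq_pmf_entropy:
  assumes b: "1 < b" and X: "simple_function M X"
  shows "rv_entropy b M X = pmf_entropy b (rv_law M X)"
  unfolding rv_entropy_def
proof (rule entropy_count_space_pmf[OF b])
  show "countable (X ` space M)" using X by (simp add: simple_function_def countable_finite)
  show "X \<in> measurable M (count_space (X ` space M))" using X by (auto simp: simple_function_def measurable_count_space_eq2)
qed (use X set_rv_law_subset in \<open>auto simp: pmf_rv_law[OF prob_space_axioms X] finite_set_rv_law\<close>)

text \<open>The chain rule; its integrability conditions hold because \<open>D\<close> has finite
  support.\<close>

lemma cond_entropy_count_space_pmf:
  assumes b: "1 < b"
    and A: "countable A" and X: "X \<in> measurable M (count_space A)"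
    and B: "countable B" and Y: "Y \<in> measurable M (count_space B)"
    and D: "\<And>x y. x \<in> A \<Longrightarrow> y \<in> B \<Longrightarrow> prob ((\<lambda>\<omega>. (X \<omega>, Y \<omega>)) -` {(x, y)} \<inter> space M) = pmf D (x, y)"
    and fin: "finite (set_pmf D)" "set_pmf D \<subseteq> A \<times> B"
    and D': "\<And>y. y \<in> B \<Longrightarrow> prob (Y -` {y} \<inter> space M) = pmf (map_pmf snd D) y"
  shows "conditional_entropy b (count_space A) (count_space B) X Y =
    pmf_entropy b D - pmf_entropy b (map_pmf snd D)"
proof -
  interpret information_space M b using b by unfold_locales
  let ?AB = "count_space A \<Otimes>\<^sub>M count_space B"
  have AB: "?AB = count_space (A \<times> B)" using A B by (rule pair_measure_countable)
  have XY: "(\<lambda>\<omega>. (X \<omega>, Y \<omega>)) \<in> measurable M (count_space (A \<times> B))"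
    using X Y AB by (metis measurable_Pair)
  have cAB: "countable (A \<times> B)" using A B by simp
  have dXY: "distributed M ?AB (\<lambda>\<omega>. (X \<omega>, Y \<omega>)) (\<lambda>v. ennreal (pmf D v))"
    unfolding AB by (rule distributed_count_space_pmf[OF cAB XY]) (use D in auto)
  have dY: "distributed M (count_space B) Y (\<lambda>y. ennreal (pmf (map_pmf snd D) y))"
    by (rule distributed_count_space_pmf[OF B Y D'])
  have int: "integrable (count_space (A \<times> B)) (\<lambda>v. pmf D v * f v)" for f :: "_ \<Rightarrow> real"
    unfolding abs_summable_on_def[symmetric]
    using abs_summable_on_finite[OF fin(1)] fin(2)
    by (subst abs_summable_on_cong_neutral[where B = "set_pmf D"]) (auto simp: set_pmf_eq)
  have "conditional_entropy b (count_space A) (count_space B) X Y =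
      entropy b (count_space (A \<times> B)) (\<lambda>\<omega>. (X \<omega>, Y \<omega>)) - entropy b (count_space B) Y"
    unfolding AB[symmetric]
    by (rule conditional_entropy_eq_entropy[OF _ _ dY _ dXY])
      (use int in \<open>auto simp: AB sigma_finite_measure_count_space_countable A B\<close>)
  also have "entropy b (count_space (A \<times> B)) (\<lambda>\<omega>. (X \<omega>, Y \<omega>)) = pmf_entropy b D"
    by (rule entropy_count_space_pmf[OF b cAB XY _ fin]) (use D in auto)
  also have "entropy b (count_space B) Y = pmf_entropy b (map_pmf snd D)"
    by (rule entropy_count_space_pmf[OF b B Y D']) (use fin in auto)
  finally show ?thesis .
qed

lemma rv_cond_entropy_eq_pmf_entropy:
  assumes b: "1 < b" and X: "simple_function M X" and Y: "simple_function M Y"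
  shows "rv_cond_entropy b M X Y =
    pmf_entropy b (rv_law M (\<lambda>\<omega>. (X \<omega>, Y \<omega>))) - pmf_entropy b (rv_law M Y)"
proof -
  have XY: "simple_function M (\<lambda>\<omega>. (X \<omega>, Y \<omega>))" using X Y by (rule simple_function_Pair)
  have snd: "map_pmf snd (rv_law M (\<lambda>\<omega>. (X \<omega>, Y \<omega>))) = rv_law M Y"
    using rv_law_comp[OF XY, of snd] by simp
  have set: "set_pmf (rv_law M (\<lambda>\<omega>. (X \<omega>, Y \<omega>))) \<subseteq> X ` space M \<times> Y ` space M"
    using AE_rv_law_iff[OF XY, of "\<lambda>v. v \<in> X ` space M \<times> Y ` space M"] by auto
  show ?thesis
    unfolding rv_cond_entropy_def
    by (subst snd[symmetric], rule cond_entropy_count_space_pmf[OF b _ _ _ _ _ _ set])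
      (use X Y in \<open>auto simp: simple_function_def measurable_count_space_eq2 countable_finite
        snd pmf_rv_law[OF prob_space_axioms XY] pmf_rv_law[OF prob_space_axioms Y] finite_set_rv_law[OF XY]\<close>)
qed

lemma rv_cond_entropy_eq_0_iff:
  assumes b: "1 < b" and X: "simple_function M X" and Y: "simple_function M Y"
  shows "rv_cond_entropy b M X Y = 0 \<longleftrightarrow> (\<exists>f. AE \<omega> in M. X \<omega> = f (Y \<omega>))"
proof -
  have XY: "simple_function M (\<lambda>\<omega>. (X \<omega>, Y \<omega>))" using X Y by (rule simple_function_Pair)
  let ?p = "rv_law M (\<lambda>\<omega>. (X \<omega>, Y \<omega>))"
  have "rv_cond_entropy b M X Y = pmf_entropy b (map_pmf (\<lambda>v. (fst v, snd v)) ?p) - pmf_entropy b (map_pmf snd ?p)"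
    using rv_law_comp[OF XY, of snd] by (simp add: rv_cond_entropy_eq_pmf_entropy[OF b X Y])
  then have "rv_cond_entropy b M X Y = 0 \<longleftrightarrow> (\<exists>f. \<forall>v\<in>set_pmf ?p. fst v = f (snd v))"
    using pmf_entropy_pair_eq_iff[OF b finite_set_rv_law[OF XY], of fst snd] by simp
  also have "\<dots> \<longleftrightarrow> (\<exists>f. AE \<omega> in M. X \<omega> = f (Y \<omega>))"
    using AE_rv_law_iff[OF XY, of "\<lambda>v. fst v = f (snd v)" for f] by simp
  finally show ?thesis .
qed

end

text \<open>The sample space is the whole outcome type, including points of mass zero.
  \<open>sk_key\<close> thus has infinite range and is no simple function, so countability of the
  value types takes over.\<close>

lemma rv_cond_entropy_measure_pmf:
  fixes X :: "'a \<Rightarrow> 'x :: countable" and Y :: "'a \<Rightarrow> 'y :: countable"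
  assumes b: "1 < b" and fin: "finite (set_pmf (map_pmf (\<lambda>\<omega>. (X \<omega>, Y \<omega>)) p))"
  shows "rv_cond_entropy b (measure_pmf p) X Y =
    pmf_entropy b (map_pmf (\<lambda>\<omega>. (X \<omega>, Y \<omega>)) p) - pmf_entropy b (map_pmf Y p)"
proof -
  have "rv_cond_entropy b (measure_pmf p) X Y = pmf_entropy b (map_pmf (\<lambda>\<omega>. (X \<omega>, Y \<omega>)) p) -
      pmf_entropy b (map_pmf snd (map_pmf (\<lambda>\<omega>. (X \<omega>, Y \<omega>)) p))"
    unfolding rv_cond_entropy_def
    by (rule measure_pmf.cond_entropy_count_space_pmf[OF b])
      (use fin in \<open>auto simp: pmf_map pmf.map_comp comp_def\<close>)
  then show ?thesis by (simp add: pmf.map_comp comp_def)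
qed

section \<open>Common information of modular families\<close>

abbreviation entropy_of :: "real \<Rightarrow> 'a pmf \<Rightarrow> ('a \<Rightarrow> 'x) \<Rightarrow> real" where
  "entropy_of b p X \<equiv> pmf_entropy b (map_pmf X p)"

text \<open>The hypothesis \<open>modular\<close> is the only trace of the independence of the edge variables.
  The combination of two users costs \<open>2 H(F)\<close> since \<open>H(F, W A) + H(F, W B)\<close> exceeds
  \<open>H(F, W (A \<inter> B)) + H(W (A \<union> B))\<close> by at most that much.\<close>

lemma pmf_entropy_recoverable_Int:
  fixes \<delta> :: real
  assumes b: "1 < b" and fin: "finite (set_pmf p)" and J: "finite J" and I: "finite I" "I \<noteq> {}"
    and A: "\<And>i. i \<in> I \<Longrightarrow> A i \<subseteq> J"
    and modular: "\<And>B. B \<subseteq> J \<Longrightarrow> pmf_entropy b (map_pmf (W B) p) = (\<Sum>j\<in>B. c j)"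
    and W_Un: "\<And>B C \<omega>. B \<subseteq> J \<Longrightarrow> C \<subseteq> J \<Longrightarrow> W (B \<union> C) \<omega> = u B C (W B \<omega>, W C \<omega>)"
    and W: "\<And>B C \<omega>. B \<subseteq> C \<Longrightarrow> C \<subseteq> J \<Longrightarrow> W B \<omega> = r B C (W C \<omega>)"
    and rec: "\<And>i. i \<in> I \<Longrightarrow> pmf_entropy b (map_pmf (\<lambda>\<omega>. (K \<omega>, F \<omega>, W (A i) \<omega>)) p)
      - pmf_entropy b (map_pmf (\<lambda>\<omega>. (F \<omega>, W (A i) \<omega>)) p) \<le> \<delta>"
  shows "pmf_entropy b (map_pmf (\<lambda>\<omega>. (K \<omega>, F \<omega>, W (\<Inter>i\<in>I. A i) \<omega>)) p)
      - pmf_entropy b (map_pmf (\<lambda>\<omega>. (F \<omega>, W (\<Inter>i\<in>I. A i) \<omega>)) p)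
    \<le> card I * \<delta> + 2 * (real (card I) - 1) * pmf_entropy b (map_pmf F p)"
  using I A rec
proof (induction I rule: finite_ne_induct)
  case (singleton i)
  then show ?case by simp
next
  case (insert i I)
  note mono = pmf_entropy_map_mono[OF b fin]
  define B C where "B = (\<Inter>i\<in>I. A i)" and "C = A i \<inter> B"
  have sub: "A i \<subseteq> J" "B \<subseteq> J" "C \<subseteq> A i" "C \<subseteq> B" "C \<subseteq> J" "A i \<union> B \<subseteq> J"
    using insert.hyps insert.prems(1) by (auto simp: B_def C_def)
  have IH: "entropy_of b p (\<lambda>\<omega>. (K \<omega>, F \<omega>, W B \<omega>)) - entropy_of b p (\<lambda>\<omega>. (F \<omega>, W B \<omega>)) \<le> card I * \<delta> + 2 * (real (card I) - 1) * entropy_of b p F"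
    using insert.IH insert.prems by (simp add: B_def)
  have i: "entropy_of b p (\<lambda>\<omega>. (K \<omega>, F \<omega>, W (A i) \<omega>)) - entropy_of b p (\<lambda>\<omega>. (F \<omega>, W (A i) \<omega>)) \<le> \<delta>"
    using insert.prems by simp
  \<comment> \<open>Submodularity over \<open>(K, F, W C)\<close>. Next, the first term on the left
    is lowered to \<open>H(W (A i \<union> B))\<close>, and on the right \<open>W C\<close> is
    absorbed into \<open>W (A i)\<close> and \<open>W B\<close>; recoverability then removes
    \<open>K\<close>, and subadditivity splits off \<open>F\<close> twice.\<close>
  have "entropy_of b p (\<lambda>\<omega>. (W (A i) \<omega>, W B \<omega>, K \<omega>, F \<omega>, W C \<omega>)) + entropy_of b p (\<lambda>\<omega>. (K \<omega>, F \<omega>, W C \<omega>)) \<le>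
      entropy_of b p (\<lambda>\<omega>. (W (A i) \<omega>, K \<omega>, F \<omega>, W C \<omega>)) + entropy_of b p (\<lambda>\<omega>. (W B \<omega>, K \<omega>, F \<omega>, W C \<omega>))"
    by (rule pmf_entropy_submodular[OF b fin])
  moreover have KF: "entropy_of b p (\<lambda>\<omega>. (W D \<omega>, K \<omega>, F \<omega>, W C \<omega>)) \<le> entropy_of b p (\<lambda>\<omega>. (K \<omega>, F \<omega>, W D \<omega>))"
    if "C \<subseteq> D" "D \<subseteq> J" for D
    using mono[of "\<lambda>(k, f, w). (w, k, f, r C D w)" "\<lambda>\<omega>. (K \<omega>, F \<omega>, W D \<omega>)"] W[OF that]
    by simp
  moreover have "entropy_of b p (\<lambda>\<omega>. (W (A i) \<omega>, W B \<omega>)) \<le> entropy_of b p (\<lambda>\<omega>. (W (A i) \<omega>, W B \<omega>, K \<omega>, F \<omega>, W C \<omega>))"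
    using mono[of "\<lambda>(x, y, z). (x, y)" "\<lambda>\<omega>. (W (A i) \<omega>, W B \<omega>, K \<omega>, F \<omega>, W C \<omega>)"] by simp
  moreover have "W (A i \<union> B) = (\<lambda>\<omega>. u (A i) B (W (A i) \<omega>, W B \<omega>))"
    using W_Un[OF sub(1,2)] by blast
  then have "entropy_of b p (W (A i \<union> B)) \<le> entropy_of b p (\<lambda>\<omega>. (W (A i) \<omega>, W B \<omega>))"
    using mono[of "u (A i) B" "\<lambda>\<omega>. (W (A i) \<omega>, W B \<omega>)"] by simp
  moreover have F: "entropy_of b p (\<lambda>\<omega>. (F \<omega>, W D \<omega>)) \<le> entropy_of b p F + entropy_of b p (W D)" for D
    by (rule pmf_entropy_pair_le[OF b fin])
  moreover have "entropy_of b p (W C) \<le> entropy_of b p (\<lambda>\<omega>. (F \<omega>, W C \<omega>))"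
    using mono[of snd "\<lambda>\<omega>. (F \<omega>, W C \<omega>)"] by simp
  \<comment> \<open>Modularity leaves exactly \<open>H(W C)\<close> after the union is subtracted,
    and this is at most \<open>H(F, W C)\<close>, the term wanted on the left.\<close>
  moreover have "entropy_of b p (W (A i)) + entropy_of b p (W B) = entropy_of b p (W (A i \<union> B)) + entropy_of b p (W C)"
    unfolding C_def using sub J
    by (simp add: modular le_infI1 sum.union_inter finite_subset)
  ultimately have "entropy_of b p (\<lambda>\<omega>. (K \<omega>, F \<omega>, W C \<omega>)) - entropy_of b p (\<lambda>\<omega>. (F \<omega>, W C \<omega>)) \<le>
      \<delta> + (card I * \<delta> + 2 * (real (card I) - 1) * entropy_of b p F) + 2 * entropy_of b p F"
    using IH i KF[OF sub(3,1)] KF[OF sub(4,2)] F[of "A i"] F[of B] by linarith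
  also have "\<dots> = card (insert i I) * \<delta> + 2 * (real (card (insert i I)) - 1) * entropy_of b p F"
    using insert.hyps by (simp add: algebra_simps)
  finally show ?case by (simp add: B_def C_def)
qed

section \<open>Hypergraphical sources\<close>

lemma simple_function_rv_tuple:
  assumes I: "finite I" and X: "\<And>i. i \<in> I \<Longrightarrow> simple_function M (X i)"
  shows "simple_function M (rv_tuple I X)"
  unfolding simple_function_def
proof (intro conjI ballI)
  have "rv_tuple I X ` space M \<subseteq> (\<Pi>\<^sub>E i\<in>I. X i ` space M)"
    by (auto simp: rv_tuple_def)
  moreover have "finite (\<Pi>\<^sub>E i\<in>I. X i ` space M)"
    using I X by (intro finite_PiE) (auto simp: simple_function_def)
  ultimately show "finite (rv_tuple I X ` space M)" by (rule finite_subset)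
next
  fix f assume "f \<in> rv_tuple I X ` space M"
  then have f: "f \<in> extensional I" by (auto simp: rv_tuple_def)
  have eq: "rv_tuple I X -` {f} \<inter> space M = {\<omega>\<in>space M. \<forall>i\<in>I. X i \<omega> = f i}"
    using f by (auto simp: rv_tuple_def fun_eq_iff restrict_def extensional_def)
  have "{\<omega>\<in>space M. X i \<omega> = f i} \<in> sets M" if "i \<in> I" for i
    using measurable_sets[OF measurable_simple_function[OF X[OF that]], of "{f i}"]
    by (simp add: vimage_def Int_def conj_commute)
  then show "rv_tuple I X -` {f} \<inter> space M \<in> sets M"
    unfolding eq by (intro sets.sets_Collect_finite_All) (use I in auto)
qed

text \<open>The default \<open>undefined\<close> is the value of \<open>rv_tuple\<close> outside
  \<open>I\<close>, so both laws vanish off \<open>extensional I\<close>; on it, independence gives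
  the product of the marginals.\<close>

lemma (in prob_space) rv_law_tuple_indep:
  assumes I: "finite I" and X: "\<And>i. i \<in> I \<Longrightarrow> simple_function M (X i)"
    and indep: "indep_vars (\<lambda>_. count_space UNIV) X I"
  shows "rv_law M (rv_tuple I X) = Pi_pmf I undefined (\<lambda>i. rv_law M (X i))"
proof (rule pmf_eqI)
  fix f
  have simple: "simple_function M (rv_tuple I X)" by (rule simple_function_rv_tuple[OF I X])
  show "pmf (rv_law M (rv_tuple I X)) f = pmf (Pi_pmf I undefined (\<lambda>i. rv_law M (X i))) f"
  proof (cases "f \<in> extensional I")
    case False
    then have "rv_tuple I X -` {f} \<inter> space M = {}" by (auto simp: rv_tuple_def)
    with False show ?thesis
      by (subst pmf_rv_law[OF prob_space_axioms simple]) (auto simp: pmf_Pi I extensional_def)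
  next
    case True
    have "prob (rv_tuple I X -` {f} \<inter> space M) = (\<Prod>i\<in>I. prob (X i -` {f i} \<inter> space M))"
    proof (cases "I = {}")
      case True
      with \<open>f \<in> extensional I\<close> have "rv_tuple I X -` {f} \<inter> space M = space M"
        by (auto simp: rv_tuple_def extensional_def fun_eq_iff)
      with True show ?thesis by (simp add: prob_space)
    next
      case False
      have "rv_tuple I X -` {f} \<inter> space M = (\<Inter>i\<in>I. X i -` {f i} \<inter> space M)"
        using \<open>f \<in> extensional I\<close> False
        by (auto simp: rv_tuple_def fun_eq_iff restrict_def extensional_def)
      then show ?thesis using indep_varsD_finite[OF indep False I, of "\<lambda>i. {f i}"] by simp
    qed
    also have "\<dots> = (\<Prod>i\<in>I. pmf (rv_law M (X i)) (f i))"
      by (intro prod.cong refl) (simp add: pmf_rv_law[OF prob_space_axioms X])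
    also have "\<dots> = pmf (Pi_pmf I undefined (\<lambda>i. rv_law M (X i))) f"
      using True by (subst pmf_Pi) (auto simp: I extensional_def)
    finally show ?thesis by (simp add: pmf_rv_law[OF prob_space_axioms simple])
  qed
qed

locale hypergraphical_source = prob_space M
  for M :: "'a measure" +
  fixes b :: real and V :: "'i set" and Z :: "'i \<Rightarrow> 'a \<Rightarrow> 'z"
    and E :: "'e set" and \<xi> :: "'e \<Rightarrow> 'i set" and X :: "'e \<Rightarrow> 'a \<Rightarrow> 'x"
  assumes b: "1 < b" and finite_V: "finite V" and V_nonempty: "V \<noteq> {}"
    and simple_Z: "i \<in> V \<Longrightarrow> simple_function M (Z i)"
    and hypergraphical: "hypergraphical b M V Z E \<xi> X"
begin

lemma finite_E: "finite E"
  using hypergraphical by (simp add: hypergraphical_def)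

lemma incident_subset: "e \<in> E \<Longrightarrow> \<xi> e \<subseteq> V"
  using hypergraphical by (auto simp: hypergraphical_def)

lemma incident_nonempty: "e \<in> E \<Longrightarrow> \<xi> e \<noteq> {}"
  using hypergraphical by (auto simp: hypergraphical_def)

lemma simple_X: "e \<in> E \<Longrightarrow> simple_function M (X e)"
  using hypergraphical by (simp add: hypergraphical_def)

definition edges_at :: "'i \<Rightarrow> 'e set" where
  "edges_at i = {e \<in> E. i \<in> \<xi> e}"

definition full_edges :: "'e set" where
  "full_edges = {e \<in> E. \<xi> e = V}"

lemma edges_at_subset: "edges_at i \<subseteq> E"
  by (auto simp: edges_at_def)

lemma full_edges_subset: "i \<in> V \<Longrightarrow> full_edges \<subseteq> edges_at i" "full_edges \<subseteq> E"
  by (auto simp: edges_at_def full_edges_def)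

text \<open>An edge seen by everybody satisfies \<open>\<xi> e = V\<close> because incidence sets
  lie in \<open>V\<close>; nonemptiness of \<open>V\<close> keeps the intersection inside
  \<open>E\<close>.\<close>

lemma Inter_edges_at: "(\<Inter>i\<in>V. edges_at i) = full_edges"
  using incident_subset V_nonempty by (fastforce simp: edges_at_def full_edges_def)

lemma simple_X_tuple: "A \<subseteq> E \<Longrightarrow> simple_function M (rv_tuple A X)"
  using finite_E simple_X by (intro simple_function_rv_tuple) (auto elim: finite_subset)

lemma restrict_X_tuple: "A \<subseteq> B \<Longrightarrow> restrict (rv_tuple B X \<omega>) A = rv_tuple A X \<omega>"
  by (auto simp: rv_tuple_def fun_eq_iff)

definition edge_law :: "'e \<Rightarrow> 'x pmf" where
  "edge_law e = rv_law M (X e)"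

lemma finite_edge_law: "e \<in> E \<Longrightarrow> finite (set_pmf (edge_law e))"
  unfolding edge_law_def by (intro finite_set_rv_law simple_X)

lemma law_X_tuple:
  assumes "A \<subseteq> E"
  shows "rv_law M (rv_tuple A X) = Pi_pmf A undefined edge_law"
proof -
  have "indep_vars (\<lambda>_. count_space UNIV) X A"
    using indep_vars_subset[OF _ assms] hypergraphical by (auto simp: hypergraphical_def)
  then show ?thesis
    unfolding edge_law_def using assms finite_E simple_X
    by (intro rv_law_tuple_indep) (auto elim: finite_subset)
qed

lemma entropy_X_tuple:
  assumes "A \<subseteq> E"
  shows "pmf_entropy b (rv_law M (rv_tuple A X)) = (\<Sum>e\<in>A. pmf_entropy b (edge_law e))"
  unfolding law_X_tuple[OF assms] using assms finite_edge_law finite_E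
  by (intro pmf_entropy_Pi_pmf) (auto elim: finite_subset)

text \<open>Equivalence up to bijection as a pair of almost sure maps: \<alpha> reads the edges off
  an observation, for feasibility and key generation, and \<gamma> rebuilds the observation from its
  edges, for the upper bounds.\<close>

lemma obtain_observation_maps:
  obtains \<alpha> \<gamma> where "\<And>i. i \<in> V \<Longrightarrow> AE \<omega> in M. rv_tuple (edges_at i) X \<omega> = \<alpha> i (Z i \<omega>)"
    and "\<And>i. i \<in> V \<Longrightarrow> AE \<omega> in M. Z i \<omega> = \<gamma> i (rv_tuple (edges_at i) X \<omega>)"
proof -
  have equiv: "rv_equiv b M (Z i) (rv_tuple (edges_at i) X)" if "i \<in> V" for i
    using hypergraphical that by (simp add: hypergraphical_def edges_at_def)
  have "\<exists>f. AE \<omega> in M. rv_tuple (edges_at i) X \<omega> = f (Z i \<omega>)"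
    "\<exists>f. AE \<omega> in M. Z i \<omega> = f (rv_tuple (edges_at i) X \<omega>)" if "i \<in> V" for i
    using equiv[OF that] simple_Z[OF that] simple_X_tuple[OF edges_at_subset]
    by (simp_all add: rv_equiv_def rv_cond_entropy_eq_0_iff[OF b])
  then show ?thesis using that by metis
qed

section \<open>The common edges as optimal common information\<close>

lemma gk_feasible_full_edges: "gk_feasible b M V Z (rv_tuple full_edges X)"
  unfolding gk_feasible_def
proof (intro conjI ballI)
  show simple: "simple_function M (rv_tuple full_edges X)"
    by (rule simple_X_tuple[OF full_edges_subset(2)])
  obtain \<alpha> where \<alpha>: "\<And>i. i \<in> V \<Longrightarrow> AE \<omega> in M. rv_tuple (edges_at i) X \<omega> = \<alpha> i (Z i \<omega>)"
    using obtain_observation_maps by metis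
  fix i assume i: "i \<in> V"
  have "AE \<omega> in M. rv_tuple full_edges X \<omega> = restrict (\<alpha> i (Z i \<omega>)) full_edges"
    using \<alpha>[OF i] by eventually_elim (metis restrict_X_tuple[OF full_edges_subset(1)[OF i]])
  then show "rv_cond_entropy b M (rv_tuple full_edges X) (Z i) = 0"
    by (subst rv_cond_entropy_eq_0_iff[OF b simple simple_Z[OF i]])
      (rule exI[of _ "\<lambda>z. restrict (\<alpha> i z) full_edges"])
qed

lemma gk_feasible_le:
  assumes "gk_feasible b M V Z G"
  shows "rv_entropy b M G \<le> rv_entropy b M (rv_tuple full_edges X)"
proof -
  have G: "simple_function M G" and "\<And>i. i \<in> V \<Longrightarrow> rv_cond_entropy b M G (Z i) = 0"
    using assms by (auto simp: gk_feasible_def)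
  then obtain g where g: "\<And>i. i \<in> V \<Longrightarrow> AE \<omega> in M. G \<omega> = g i (Z i \<omega>)"
    using rv_cond_entropy_eq_0_iff[OF b G simple_Z] by metis
  obtain \<gamma> where \<gamma>: "\<And>i. i \<in> V \<Longrightarrow> AE \<omega> in M. Z i \<omega> = \<gamma> i (rv_tuple (edges_at i) X \<omega>)"
    using obtain_observation_maps by metis
  \<comment> \<open>From here on the sample is the finitely supported pair of \<open>G\<close> and
    all edge values.\<close>
  define p where "p = rv_law M (\<lambda>\<omega>. (G \<omega>, rv_tuple E X \<omega>))"
  define W where "W = (\<lambda>A (v :: 'b \<times> ('e \<Rightarrow> 'x)). restrict (snd v) A)"
  have simple: "simple_function M (\<lambda>\<omega>. (G \<omega>, rv_tuple E X \<omega>))"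
    using G simple_X_tuple by (intro simple_function_Pair) auto
  have fin: "finite (set_pmf p)" unfolding p_def by (rule finite_set_rv_law[OF simple])
  have map_p: "map_pmf f p = rv_law M (\<lambda>\<omega>. f (G \<omega>, rv_tuple E X \<omega>))" for f :: "_ \<Rightarrow> 'y"
    unfolding p_def by (rule rv_law_comp[OF simple, symmetric])
  have W_p: "map_pmf (W A) p = rv_law M (rv_tuple A X)" if "A \<subseteq> E" for A
    unfolding map_p W_def by (simp add: restrict_X_tuple[OF that])
  have const: "pmf_entropy b (return_pmf ()) = 0" by (simp add: pmf_entropy_def)
  \<comment> \<open>\<open>G\<close> is exactly a function of \<open>Z i\<close>, hence of the edges
    at \<open>i\<close>, so each user has defect \<delta> = 0.\<close>
  have rec: "entropy_of b p (\<lambda>v. (fst v, (), W (edges_at i) v)) - entropy_of b p (\<lambda>v. ((), W (edges_at i) v)) \<le> 0"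
    if i: "i \<in> V" for i
  proof -
    have "AE \<omega> in M. G \<omega> = g i (\<gamma> i (restrict (rv_tuple E X \<omega>) (edges_at i)))"
      using g[OF i] \<gamma>[OF i] by eventually_elim (simp add: restrict_X_tuple[OF edges_at_subset])
    then have "\<forall>v\<in>set_pmf p. fst v = (\<lambda>(_, w). g i (\<gamma> i w)) ((), W (edges_at i) v)"
      using AE_rv_law_iff[OF simple, of "\<lambda>v. fst v = g i (\<gamma> i (restrict (snd v) (edges_at i)))"]
      by (simp add: p_def W_def)
    then have "\<exists>f. \<forall>v\<in>set_pmf p. fst v = f ((), W (edges_at i) v)"
      by (intro exI[of _ "\<lambda>(_, w). g i (\<gamma> i w)"])
    then show ?thesis
      using pmf_entropy_pair_eq_iff[OF b fin, of fst "\<lambda>v. ((), W (edges_at i) v)"] by simp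
  qed
  have "entropy_of b p (\<lambda>v. (fst v, (), W (\<Inter>i\<in>V. edges_at i) v))
      - entropy_of b p (\<lambda>v. ((), W (\<Inter>i\<in>V. edges_at i) v))
    \<le> real (card V) * 0 + 2 * (real (card V) - 1) * entropy_of b p (\<lambda>_. ())"
  \<comment> \<open>Gluing takes the second tuple outside \<open>A\<close>; it is already
    \<open>undefined\<close> off \<open>B\<close>, so the result is again a restriction.\<close>
  proof (rule pmf_entropy_recoverable_Int[where J = E and c = "\<lambda>e. pmf_entropy b (edge_law e)"
        and u = "\<lambda>A B (f, g) e. if e \<in> A then f e else g e" and r = "\<lambda>A B f. restrict f A",
        OF b fin finite_E finite_V V_nonempty])
    show "entropy_of b p (W A) = (\<Sum>e\<in>A. pmf_entropy b (edge_law e))" if "A \<subseteq> E" for A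
      unfolding W_p[OF that] by (rule entropy_X_tuple[OF that])
  next
    show "W A v = (\<lambda>f. restrict f A) (W B v)" if "A \<subseteq> B" for A B v
      using that by (auto simp: W_def fun_eq_iff)
    show "W (A \<union> B) v = (\<lambda>(f, g) e. if e \<in> A then f e else g e) (W A v, W B v)" for A B v
      by (auto simp: W_def fun_eq_iff)
  qed (rule edges_at_subset rec; assumption)+
  moreover have "entropy_of b p fst \<le> entropy_of b p (\<lambda>v. (fst v, (), W full_edges v))"
    using pmf_entropy_map_mono[OF b fin, of fst "\<lambda>v. (fst v, (), W full_edges v)"] by simp
  moreover have "entropy_of b p (\<lambda>v. ((), W full_edges v)) \<le> entropy_of b p (W full_edges)"
    by (rule pmf_entropy_map_mono[OF b fin, of "Pair ()"])
  ultimately have "entropy_of b p fst \<le> entropy_of b p (W full_edges)"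
    by (simp add: Inter_edges_at const)
  then have "pmf_entropy b (rv_law M G) \<le> pmf_entropy b (rv_law M (rv_tuple full_edges X))"
    unfolding W_p[OF full_edges_subset(2)] by (simp add: map_p)
  then show ?thesis
    using simple_X_tuple[OF full_edges_subset(2)] G by (simp add: rv_entropy_eq_pmf_entropy[OF b])
qed

text \<open>The supremum ranges over \<open>nat\<close>-valued variables, whereas the optimal tuple
  is function-valued. Numbering its finitely many values is injective, so entropy and feasibility
  survive and the supremum is attained.\<close>

lemma J_GK_eq: "J_GK b M V Z = rv_entropy b M (rv_tuple full_edges X)"
  unfolding J_GK_def
proof (rule cSup_eq_maximum)
  let ?G = "rv_tuple full_edges X"
  have simple: "simple_function M ?G" by (rule simple_X_tuple[OF full_edges_subset(2)])
  let ?f = "to_nat_on (?G ` space M)"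
  have simple': "simple_function M (\<lambda>\<omega>. ?f (?G \<omega>))"
    using simple_function_compose[OF simple, of ?f] by (simp add: comp_def)
  have inj: "inj_on ?f (?G ` space M)"
    using simple by (intro inj_on_to_nat_on) (simp add: simple_function_def countable_finite)
  have "rv_entropy b M (\<lambda>\<omega>. ?f (?G \<omega>)) = rv_entropy b M ?G"
    using inj_on_subset[OF inj set_rv_law_subset[OF simple]]
    by (simp add: rv_entropy_eq_pmf_entropy[OF b] simple simple' rv_law_comp pmf_entropy_map_inj)
  moreover have "gk_feasible b M V Z (\<lambda>\<omega>. ?f (?G \<omega>))"
    unfolding gk_feasible_def
  proof (intro conjI ballI simple')
    fix i assume i: "i \<in> V"
    obtain h where "AE \<omega> in M. ?G \<omega> = h (Z i \<omega>)"
      using gk_feasible_full_edges rv_cond_entropy_eq_0_iff[OF b simple simple_Z[OF i]] i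
      by (auto simp: gk_feasible_def)
    then have "AE \<omega> in M. ?f (?G \<omega>) = ?f (h (Z i \<omega>))" by eventually_elim simp
    then show "rv_cond_entropy b M (\<lambda>\<omega>. ?f (?G \<omega>)) (Z i) = 0"
      by (subst rv_cond_entropy_eq_0_iff[OF b simple' simple_Z[OF i]]) (rule exI[of _ "\<lambda>z. ?f (h z)"])
  qed
  ultimately show "rv_entropy b M ?G \<in> rv_entropy b M ` {G :: 'a \<Rightarrow> nat. gk_feasible b M V Z G}"
    by (intro image_eqI[where x = "\<lambda>\<omega>. ?f (?G \<omega>)"]) auto
qed (use gk_feasible_le in auto)

section \<open>Edge variables recovered from the source law\<close>

definition source_law :: "('i \<Rightarrow> 'z) pmf" where
  "source_law = rv_law M (rv_tuple V Z)"

lemma simple_Z_tuple: "simple_function M (rv_tuple V Z)"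
  using finite_V simple_Z by (rule simple_function_rv_tuple)

lemma finite_source_law: "finite (set_pmf source_law)"
  unfolding source_law_def by (rule finite_set_rv_law[OF simple_Z_tuple])

text \<open>Schemes know only the law of the source tuple, not \<open>M\<close>. Since the users
  jointly observe every edge, all edge values are a function \<open>Y\<close> of a source symbol,
  and the almost sure relations become valid at every support point.\<close>

lemma obtain_edge_values:
  obtains Y \<alpha> \<gamma> where "map_pmf Y source_law = Pi_pmf E undefined edge_law"
    and "\<And>z i. z \<in> set_pmf source_law \<Longrightarrow> i \<in> V \<Longrightarrow> restrict (Y z) (edges_at i) = \<alpha> i (z i)"
    and "\<And>z i. z \<in> set_pmf source_law \<Longrightarrow> i \<in> V \<Longrightarrow> z i = \<gamma> i (restrict (Y z) (edges_at i))"
proof -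
  obtain \<alpha> \<gamma> where \<alpha>: "\<And>i. i \<in> V \<Longrightarrow> AE \<omega> in M. rv_tuple (edges_at i) X \<omega> = \<alpha> i (Z i \<omega>)"
    and \<gamma>: "\<And>i. i \<in> V \<Longrightarrow> AE \<omega> in M. Z i \<omega> = \<gamma> i (rv_tuple (edges_at i) X \<omega>)"
    by (rule obtain_observation_maps) blast
  \<comment> \<open>Each edge is read off the observation of one chosen incident user; one exists
    because \<open>\<xi> e\<close> is nonempty.\<close>
  define \<iota> where "\<iota> = (\<lambda>e. SOME i. i \<in> \<xi> e)"
  have \<iota>: "\<iota> e \<in> V" "e \<in> edges_at (\<iota> e)" if "e \<in> E" for e
    using some_in_eq[of "\<xi> e"] incident_nonempty[OF that] incident_subset[OF that] that
    by (auto simp: \<iota>_def edges_at_def)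
  define Y where "Y = (\<lambda>z. \<lambda>e\<in>E. \<alpha> (\<iota> e) (z (\<iota> e)) e)"
  have "AE \<omega> in M. \<forall>i\<in>V. rv_tuple (edges_at i) X \<omega> = \<alpha> i (Z i \<omega>)"
    by (rule AE_finite_allI[OF finite_V \<alpha>])
  then have Y: "AE \<omega> in M. Y (rv_tuple V Z \<omega>) = rv_tuple E X \<omega>"
  proof eventually_elim
    case (elim \<omega>)
    have "\<alpha> (\<iota> e) (Z (\<iota> e) \<omega>) e = X e \<omega>" if "e \<in> E" for e
      using elim \<iota>[OF that] by (metis rv_tuple_def restrict_apply')
    then show ?case using \<iota> by (auto simp: Y_def rv_tuple_def fun_eq_iff)
  qed
  have simple_Y: "simple_function M (\<lambda>\<omega>. Y (rv_tuple V Z \<omega>))"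
    using simple_function_compose[OF simple_Z_tuple, of Y] by (simp add: comp_def)
  show ?thesis
  proof (rule that)
    show "map_pmf Y source_law = Pi_pmf E undefined edge_law"
      unfolding source_law_def rv_law_comp[OF simple_Z_tuple, symmetric] law_X_tuple[OF subset_refl, symmetric]
      by (rule rv_law_cong_AE[OF simple_Y simple_X_tuple[OF subset_refl] Y])
  next
    fix z i assume z: "z \<in> set_pmf source_law" and i: "i \<in> V"
    have "AE \<omega> in M. restrict (Y (rv_tuple V Z \<omega>)) (edges_at i) = \<alpha> i (rv_tuple V Z \<omega> i)"
      using Y \<alpha>[OF i]
      by eventually_elim (simp add: restrict_X_tuple[OF edges_at_subset], simp add: rv_tuple_def i)
    then show "restrict (Y z) (edges_at i) = \<alpha> i (z i)"
      using z by (simp add: source_law_def AE_rv_law_iff[OF simple_Z_tuple, of "\<lambda>z. restrict (Y z) (edges_at i) = \<alpha> i (z i)"])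
    have "AE \<omega> in M. rv_tuple V Z \<omega> i = \<gamma> i (restrict (Y (rv_tuple V Z \<omega>)) (edges_at i))"
      using Y \<gamma>[OF i]
      by eventually_elim (simp add: restrict_X_tuple[OF edges_at_subset], simp add: rv_tuple_def i)
    then show "z i = \<gamma> i (restrict (Y z) (edges_at i))"
      using z by (simp add: source_law_def AE_rv_law_iff[OF simple_Z_tuple, of "\<lambda>z. z i = \<gamma> i (restrict (Y z) (edges_at i))"])
  qed
qed

end

section \<open>Converse\<close>

text \<open>In order: key, discussion, capped private randomness, edge values at each time.\<close>

type_synonym ('e, 'x) finite_view = "nat \<times> nat list \<times> (nat \<Rightarrow> nat) \<times> (nat \<Rightarrow> 'e \<Rightarrow> 'x)"

locale sk_source = hypergraphical_source M b V Z E \<xi> X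
  for M :: "'a measure" and b :: real and V :: "nat set" and Z :: "nat \<Rightarrow> 'a \<Rightarrow> 'z"
    and E :: "'e set" and \<xi> :: "'e \<Rightarrow> nat set" and X :: "'e \<Rightarrow> 'a \<Rightarrow> 'x" +
  assumes card_V: "2 \<le> card V"
begin

definition common_entropy :: real where
  "common_entropy = (\<Sum>e\<in>full_edges. pmf_entropy b (edge_law e))"

text \<open>A private index belongs to one user only, so it cannot survive the intersection over at
  least two users.\<close>

lemma Inter_user_variables: "(\<Inter>i\<in>V. {i} <+> edges_at i) = {} <+> full_edges"
proof -
  have "\<not> (\<forall>i\<in>V. i = j)" for j
  proof
    assume "\<forall>i\<in>V. i = j"
    then have "card V \<le> card {j}" by (intro card_mono) auto
    then show False using card_V by simp
  qed
  then show ?thesis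
    using V_nonempty by (auto simp: Inter_edges_at[symmetric])
qed

text \<open>Truncating the private randomness at \<open>N\<close> makes all variables finitely valued, at the price
  of the additional error probability \<open>\<eta>\<close>.\<close>

lemma key_entropy_le_truncated:
  assumes S: "sk_valid V source_law n S"
    and \<eta>: "measure_pmf.prob (sk_joint S) {\<omega>. \<exists>i\<in>V. N < fst \<omega> i} \<le> \<eta>"
  shows "rv_cond_entropy b (measure_pmf (sk_joint S)) sk_key (sk_discussion n S) \<le>
    n * common_entropy
    + card V * (log b 2 + (sk_error V n S + \<eta>) * log b (card (sk_K_alphabet S)))
    + 2 * (real (card V) - 1) * log b (card (sk_F_alphabet S))"
proof -
  obtain Y \<alpha> \<gamma> where Y: "map_pmf Y source_law = Pi_pmf E undefined edge_law"
    and \<gamma>: "\<And>z i. z \<in> set_pmf source_law \<Longrightarrow> i \<in> V \<Longrightarrow> z i = \<gamma> i (restrict (Y z) (edges_at i))"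
    by (rule obtain_edge_values) (rule that; assumption)
  let ?q = "sk_joint S"
  define trunc where "trunc = (\<lambda>\<omega> :: 'z sk_outcome. (min N \<circ> fst \<omega>, Y \<circ> fst (snd \<omega>)))"
  \<comment> \<open>Only the view is truncated: key and discussion come from the full outcome and
    need not be functions of the truncated data. The intersection lemma allows this, since it takes
    \<open>K\<close> and \<open>F\<close> arbitrary.\<close>
  define p where "p = map_pmf (\<lambda>\<omega>. (sk_key \<omega>, sk_discussion n S \<omega>, trunc \<omega>)) ?q"
  define K F where "K = (\<lambda>v :: ('e, 'x) finite_view. fst v)"
    and "F = (\<lambda>v :: ('e, 'x) finite_view. fst (snd v))"
  \<comment> \<open>Coordinates outside \<open>A\<close> are reset to the defaults of the product
    laws, in the shape in which \<open>Pi_pmf_subset\<close> describes a marginal.\<close>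
  define WU where "WU = (\<lambda>(A :: (nat + 'e) set) (u :: nat \<Rightarrow> nat) i. if i \<in> {i \<in> V. Inl i \<in> A} then u i else 0)"
  define WX where "WX = (\<lambda>(A :: (nat + 'e) set) (f :: 'e \<Rightarrow> 'x) e. if e \<in> {e. Inr e \<in> A} then f e else undefined)"
  define W where "W = (\<lambda>A (v :: ('e, 'x) finite_view).
    (WU A (fst (snd (snd v))), WX A \<circ> snd (snd (snd v))))"
  define \<mu> where "\<mu> = (\<lambda>i. map_pmf (min N) (sk_private S i))"
  \<comment> \<open>Private randomness is drawn once per block, each edge variable \<open>n\<close>
    times.\<close>
  define c where "c = case_sum (\<lambda>i. pmf_entropy b (\<mu> i)) (\<lambda>e. n * pmf_entropy b (edge_law e))"

  have joint: "map_pmf (\<lambda>\<omega>. (fst \<omega>, fst (snd \<omega>))) ?q =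
      pair_pmf (Pi_pmf V 0 (sk_private S)) (Pi_pmf {..<n} (\<lambda>_. undefined) (\<lambda>_. source_law))"
    using S by (simp add: sk_valid_def case_prod_unfold)
  \<comment> \<open>Beyond the block the source symbol is \<open>\<lambda>_. undefined\<close>, so
    \<open>Y\<close> of it becomes the new default; the default 0 is fixed by
    \<open>min N\<close>.\<close>
  have law: "map_pmf trunc ?q = pair_pmf (Pi_pmf V 0 \<mu>)
      (Pi_pmf {..<n} (Y (\<lambda>_. undefined)) (\<lambda>_. Pi_pmf E undefined edge_law))"
  proof -
    have "map_pmf trunc ?q = map_pmf (\<lambda>(u, zs). (min N \<circ> u, Y \<circ> zs)) (map_pmf (\<lambda>\<omega>. (fst \<omega>, fst (snd \<omega>))) ?q)"
      by (simp add: pmf.map_comp comp_def trunc_def)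
    then show ?thesis
      unfolding joint map_pair
      by (simp add: Y[symmetric] \<mu>_def finite_V Pi_pmf_map[where f = "min N" and dflt = 0] Pi_pmf_map[where f = Y, OF _ refl])
  qed
  have fin_\<mu>: "finite (set_pmf (\<mu> i))" for i
    by (rule finite_subset[of _ "{..N}"]) (auto simp: \<mu>_def)
  have fin_edges: "finite (set_pmf (Pi_pmf A undefined edge_law))" if "A \<subseteq> E" for A
    using that finite_E finite_edge_law by (intro finite_set_Pi_pmf) (auto elim: finite_subset)
  have "finite (trunc ` set_pmf ?q)"
    unfolding set_map_pmf[symmetric] law using finite_V fin_\<mu> fin_edges
    by (simp add: finite_set_Pi_pmf)
  then have "finite (sk_K_alphabet S \<times> sk_F_alphabet S \<times> trunc ` set_pmf ?q)"
    using S by (simp add: sk_valid_def)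
  moreover have "set_pmf p \<subseteq> sk_K_alphabet S \<times> sk_F_alphabet S \<times> trunc ` set_pmf ?q"
    using S by (auto simp: p_def sk_valid_def)
  ultimately have fin: "finite (set_pmf p)" by (rule rev_finite_subset)

  have W_p: "map_pmf (W A) p = pair_pmf (Pi_pmf {i \<in> V. Inl i \<in> A} 0 \<mu>)
      (Pi_pmf {..<n} (WX A (Y (\<lambda>_. undefined))) (\<lambda>_. Pi_pmf {e. Inr e \<in> A} undefined edge_law))"
    if A: "A \<subseteq> V <+> E" for A
  proof -
    have "map_pmf (W A) p = map_pmf (\<lambda>(u, x). (WU A u, WX A \<circ> x)) (map_pmf trunc ?q)"
      by (simp add: p_def W_def pmf.map_comp comp_def case_prod_unfold)
    also have "\<dots> = pair_pmf (map_pmf (WU A) (Pi_pmf V 0 \<mu>))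
        (Pi_pmf {..<n} (WX A (Y (\<lambda>_. undefined))) (\<lambda>_. map_pmf (WX A) (Pi_pmf E undefined edge_law)))"
      unfolding law map_pair by (simp add: Pi_pmf_map[where f = "WX A", OF _ refl])
    also have "map_pmf (WU A) (Pi_pmf V 0 \<mu>) = Pi_pmf {i \<in> V. Inl i \<in> A} 0 \<mu>"
      unfolding WU_def by (rule Pi_pmf_subset[symmetric]) (auto simp: finite_V)
    also have "map_pmf (WX A) (Pi_pmf E undefined edge_law) = Pi_pmf {e. Inr e \<in> A} undefined edge_law"
      unfolding WX_def by (rule Pi_pmf_subset[symmetric]) (use A in \<open>auto simp: finite_E\<close>)
    finally show ?thesis .
  qed
  have modular: "entropy_of b p (W A) = (\<Sum>j\<in>A. c j)" if A: "A \<subseteq> V <+> E" for A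
  proof -
    have sub: "{i \<in> V. Inl i \<in> A} \<subseteq> V" "{e. Inr e \<in> A} \<subseteq> E" using A by auto
    have fin_sub: "finite {i \<in> V. Inl i \<in> A}" "finite {e. Inr e \<in> A}"
      using sub finite_V finite_E by (auto elim: finite_subset)
    have "A = {i \<in> V. Inl i \<in> A} <+> {e. Inr e \<in> A}" using A by auto
    then have "(\<Sum>j\<in>A. c j) = (\<Sum>j\<in>{i \<in> V. Inl i \<in> A} <+> {e. Inr e \<in> A}. c j)" by simp
    also have "\<dots> = (\<Sum>i | i \<in> V \<and> Inl i \<in> A. pmf_entropy b (\<mu> i)) + n * (\<Sum>e | Inr e \<in> A. pmf_entropy b (edge_law e))"
      using fin_sub by (subst sum.Plus) (auto simp: c_def sum_distrib_left)
    also have "(\<Sum>e | Inr e \<in> A. pmf_entropy b (edge_law e)) = pmf_entropy b (Pi_pmf {e. Inr e \<in> A} undefined edge_law)"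
      using sub(2) finite_edge_law by (intro pmf_entropy_Pi_pmf[symmetric] fin_sub) auto
    also have "(\<Sum>i | i \<in> V \<and> Inl i \<in> A. pmf_entropy b (\<mu> i)) + n * \<dots> = entropy_of b p (W A)"
      unfolding W_p[OF A] using fin_sub fin_\<mu> fin_edges[OF sub(2)]
      by (subst pmf_entropy_pair_pmf) (simp_all add: finite_set_Pi_pmf pmf_entropy_Pi_pmf)
    finally show ?thesis ..
  qed

  have rec: "entropy_of b p (\<lambda>v. (K v, F v, W ({i} <+> edges_at i) v)) - entropy_of b p (\<lambda>v. (F v, W ({i} <+> edges_at i) v))
      \<le> log b 2 + (sk_error V n S + \<eta>) * log b (card (sk_K_alphabet S))" if i: "i \<in> V" for i
  proof (rule pmf_entropy_fano[OF b fin])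
    show "finite (sk_K_alphabet S)" "K ` set_pmf p \<subseteq> sk_K_alphabet S"
      using S by (auto simp: sk_valid_def p_def K_def)
    \<comment> \<open>The user's own decoder, run on the capped private value and on source symbols
      rebuilt from the edges by \<gamma>.\<close>
    let ?\<phi> = "\<lambda>(f, u, x). sk_recover S i f (u i, map (\<lambda>t. \<gamma> i (x t)) [0..<n])"
    let ?err = "{\<omega>. \<exists>i\<in>V. sk_key \<omega> \<noteq> sk_recover S i (sk_discussion n S \<omega>) (sk_observation n \<omega> i)}"
    have "measure_pmf.prob p {v. K v \<noteq> ?\<phi> (F v, W ({i} <+> edges_at i) v)} =
        measure_pmf.prob ?q {\<omega>. sk_key \<omega> \<noteq> ?\<phi> (sk_discussion n S \<omega>, WU ({i} <+> edges_at i) (fst (trunc \<omega>)), WX ({i} <+> edges_at i) \<circ> snd (trunc \<omega>))}"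
      by (simp add: p_def vimage_def K_def F_def W_def)
    \<comment> \<open>On the support \<gamma> is correct, and if \<open>u i \<le> N\<close> capping
      changes nothing, so the simulation agrees with the real decoder. Every other outcome is
      charged to \<eta>.\<close>
    also have "\<dots> \<le> measure_pmf.prob ?q (?err \<union> {\<omega>. \<exists>i\<in>V. N < fst \<omega> i})"
    proof (rule measure_pmf.finite_measure_mono_AE[OF AE_pmfI])
      fix \<omega> assume \<omega>: "\<omega> \<in> set_pmf ?q"
      obtain u zs k where [simp]: "\<omega> = (u, zs, k)" by (cases \<omega>)
      have "(u, zs) \<in> set_pmf (map_pmf (\<lambda>\<omega>. (fst \<omega>, fst (snd \<omega>))) ?q)"
        using \<omega> by force
      then have zs: "zs t \<in> set_pmf source_law" if "t < n" for t
        unfolding joint using that by (auto simp: set_Pi_pmf PiE_dflt_def)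
      have obs: "map (\<lambda>t. zs t i) [0..<n] =
          map (\<lambda>t. \<gamma> i (\<lambda>e. if e \<in> edges_at i then Y (zs t) e else undefined)) [0..<n]"
        by (rule map_cong) (use \<gamma>[OF zs i] in \<open>auto simp: restrict_def\<close>)
      have "?\<phi> (sk_discussion n S \<omega>, WU ({i} <+> edges_at i) (fst (trunc \<omega>)), WX ({i} <+> edges_at i) \<circ> snd (trunc \<omega>))
          = sk_recover S i (sk_discussion n S \<omega>) (sk_observation n \<omega> i)" if "u i \<le> N"
        using that i by (simp add: sk_observation_def trunc_def WU_def WX_def Plus_def image_iff comp_def obs)
      then show "\<omega> \<in> {\<omega>. sk_key \<omega> \<noteq> ?\<phi> (sk_discussion n S \<omega>, WU ({i} <+> edges_at i) (fst (trunc \<omega>)), WX ({i} <+> edges_at i) \<circ> snd (trunc \<omega>))}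
          \<longrightarrow> \<omega> \<in> ?err \<union> {\<omega>. \<exists>i\<in>V. N < fst \<omega> i}"
        using i by (auto simp: not_less[symmetric])
    qed simp
    also have "\<dots> \<le> sk_error V n S + \<eta>"
      unfolding sk_error_def using \<eta> by (intro order.trans[OF measure_Un_le]) auto
    finally show "measure_pmf.prob p {v. K v \<noteq> ?\<phi> (F v, W ({i} <+> edges_at i) v)} \<le> sk_error V n S + \<eta>" .
  qed

  define C :: "(nat + 'e) set" where "C = {} <+> full_edges"
  have "entropy_of b p (\<lambda>v. (K v, F v, W (\<Inter>i\<in>V. {i} <+> edges_at i) v)) - entropy_of b p (\<lambda>v. (F v, W (\<Inter>i\<in>V. {i} <+> edges_at i) v))
    \<le> card V * (log b 2 + (sk_error V n S + \<eta>) * log b (card (sk_K_alphabet S)))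
      + 2 * (real (card V) - 1) * entropy_of b p F"
  proof (rule pmf_entropy_recoverable_Int[where J = "V <+> E" and c = c
        and u = "\<lambda>A B ((u, x), (u', x')). (\<lambda>i. if Inl i \<in> A then u i else u' i, \<lambda>t e. if Inr e \<in> A then x t e else x' t e)"
        and r = "\<lambda>A B (u, x). (WU A u, WX A \<circ> x)", OF b fin _ finite_V V_nonempty _ modular])
    show "W A v = (\<lambda>(u, x). (WU A u, WX A \<circ> x)) (W B v)" if "A \<subseteq> B" for A B v
      using that by (auto simp: W_def WU_def WX_def fun_eq_iff)
    show "W (A \<union> B) v = (\<lambda>((u, x), (u', x')). (\<lambda>i. if Inl i \<in> A then u i else u' i, \<lambda>t e. if Inr e \<in> A then x t e else x' t e)) (W A v, W B v)" for A B v
      by (auto simp: W_def WU_def WX_def fun_eq_iff)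
    show "{i} <+> edges_at i \<subseteq> V <+> E" if "i \<in> V" for i
      using that edges_at_subset by auto
  qed (use finite_V finite_E rec in auto)
  then have "entropy_of b p (\<lambda>v. (K v, F v, W C v)) - entropy_of b p (\<lambda>v. (F v, W C v))
    \<le> card V * (log b 2 + (sk_error V n S + \<eta>) * log b (card (sk_K_alphabet S)))
      + 2 * (real (card V) - 1) * entropy_of b p F"
    by (simp only: Inter_user_variables C_def)
  \<comment> \<open>Dropping \<open>W C\<close> from the conditioning costs at most
    \<open>H(W C)\<close>, which is \<open>n * common_entropy\<close> because \<open>C\<close>
    contains no private index.\<close>
  moreover have "entropy_of b p (\<lambda>v. (K v, F v)) \<le> entropy_of b p (\<lambda>v. (K v, F v, W C v))"
    using pmf_entropy_map_mono[OF b fin, of "\<lambda>(k, f, w). (k, f)" "\<lambda>v. (K v, F v, W C v)"] by simp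
  moreover have "entropy_of b p (\<lambda>v. (F v, W C v)) \<le> entropy_of b p F + entropy_of b p (W C)"
    by (rule pmf_entropy_pair_le[OF b fin])
  moreover have "entropy_of b p (W C) = n * common_entropy"
    unfolding C_def using full_edges_subset(2) finite_E
    by (subst modular) (auto simp: c_def common_entropy_def sum_distrib_left sum.Plus finite_subset)
  moreover have "entropy_of b p F \<le> log b (card (sk_F_alphabet S))"
    using S by (intro pmf_entropy_le_card[OF b]) (auto simp: sk_valid_def p_def F_def)
  then have "2 * (real (card V) - 1) * entropy_of b p F \<le> 2 * (real (card V) - 1) * log b (card (sk_F_alphabet S))"
    using card_V by (intro mult_left_mono) auto
  \<comment> \<open>Truncation left key and discussion alone, so this is the conditional entropy of
    the original scheme.\<close>
  moreover have "rv_cond_entropy b (measure_pmf ?q) sk_key (sk_discussion n S) =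
      entropy_of b p (\<lambda>v. (K v, F v)) - entropy_of b p F"
  proof -
    have "finite (set_pmf (map_pmf (\<lambda>v. (K v, F v)) p))" using fin by simp
    then have "finite (set_pmf (map_pmf (\<lambda>\<omega>. (sk_key \<omega>, sk_discussion n S \<omega>)) ?q))"
      by (simp add: p_def pmf.map_comp comp_def K_def F_def image_image)
    then show ?thesis
      by (simp add: rv_cond_entropy_measure_pmf[OF b] p_def pmf.map_comp comp_def K_def F_def)
  qed
  ultimately show ?thesis by linarith
qed

text \<open>The left side of the truncated bound does not depend on \<open>N\<close>, and the
  probability that one of finitely many private values exceeds \<open>N\<close> tends to 0, so
  \<eta> can be made arbitrarily small.\<close>

lemma key_entropy_le:
  assumes S: "sk_valid V source_law n S"
  shows "rv_cond_entropy b (measure_pmf (sk_joint S)) sk_key (sk_discussion n S) \<le>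
    n * common_entropy + card V * (log b 2 + sk_error V n S * log b (card (sk_K_alphabet S)))
    + 2 * (real (card V) - 1) * log b (card (sk_F_alphabet S))"
proof (rule field_le_epsilon)
  fix e :: real assume e: "0 < e"
  let ?L = "log b (card (sk_K_alphabet S))" and ?q = "sk_joint S"
  have "card (sk_K_alphabet S) > 0"
    using S set_pmf_not_empty[of ?q] by (auto simp: sk_valid_def card_gt_0_iff)
  then have L: "0 \<le> ?L" using b by simp
  \<comment> \<open>Makes the additional term at most \<open>e\<close>; the summand 1 keeps the
    denominator positive for a key alphabet of size one.\<close>
  define \<eta> where "\<eta> = e / (card V * ?L + 1)"
  have pos: "0 < card V * ?L + 1" using L by (simp add: add_nonneg_pos)
  then have \<eta>: "0 < \<eta>" using e by (simp add: \<eta>_def)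
  have "(\<lambda>N. measure_pmf.prob ?q {\<omega>. \<exists>i\<in>V. N < fst \<omega> i}) \<longlonglongrightarrow> measure_pmf.prob ?q (\<Inter>N. {\<omega>. \<exists>i\<in>V. N < fst \<omega> i})"
    by (intro measure_pmf.finite_Lim_measure_decseq) (auto simp: decseq_def intro: le_less_trans)
  also have "(\<Inter>N. {\<omega>. \<exists>i\<in>V. N < fst \<omega> i}) = ({} :: 'z sk_outcome set)"
  proof -
    have "\<not> (\<exists>i\<in>V. Max (u ` V) < u i)" for u :: "nat \<Rightarrow> nat"
      using finite_V by (auto simp: not_less)
    then show ?thesis by blast
  qed
  finally have "eventually (\<lambda>N. measure_pmf.prob ?q {\<omega>. \<exists>i\<in>V. N < fst \<omega> i} < \<eta>) sequentially"
    using order_tendstoD(2)[OF _ \<eta>] by simp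
  then obtain N where "measure_pmf.prob ?q {\<omega>. \<exists>i\<in>V. N < fst \<omega> i} < \<eta>"
    using eventually_happens'[OF sequentially_bot] by blast
  then have "measure_pmf.prob ?q {\<omega>. \<exists>i\<in>V. N < fst \<omega> i} \<le> \<eta>" by simp
  from key_entropy_le_truncated[OF S this]
  have "rv_cond_entropy b (measure_pmf ?q) sk_key (sk_discussion n S) \<le>
    n * common_entropy + card V * (log b 2 + sk_error V n S * ?L)
    + 2 * (real (card V) - 1) * log b (card (sk_F_alphabet S)) + \<eta> * (card V * ?L)"
    by (simp add: algebra_simps)
  also have "\<eta> * (card V * ?L) \<le> e"
    using pos e L by (simp add: \<eta>_def field_simps)
  finally show "rv_cond_entropy b (measure_pmf ?q) sk_key (sk_discussion n S) \<le>
    n * common_entropy + card V * (log b 2 + sk_error V n S * ?L)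
    + 2 * (real (card V) - 1) * log b (card (sk_F_alphabet S)) + e" by simp
qed

lemma liminf_key_rate_le:
  assumes S: "sk_admissible b V source_law 0 S"
  shows "liminf (\<lambda>n. ereal (sk_key_rate b n (S n))) \<le> ereal common_entropy"
proof (rule ccontr)
  assume "\<not> liminf (\<lambda>n. ereal (sk_key_rate b n (S n))) \<le> ereal common_entropy"
  then have "ereal common_entropy < liminf (\<lambda>n. ereal (sk_key_rate b n (S n)))" by simp
  then obtain c where c: "common_entropy < c" "ereal c < liminf (\<lambda>n. ereal (sk_key_rate b n (S n)))"
    using ereal_dense2[of "ereal common_entropy"] by auto
  define m where "m = real (card V)"
  have m: "2 \<le> m" using card_V by (simp add: m_def)
  \<comment> \<open>With each vanishing quantity below \<open>d\<close>, the estimate gives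
    \<open>c - common_entropy < (2 * m + 1) * d\<close>; any larger factor, here
    \<open>2 * m + 3\<close>, yields a contradiction.\<close>
  define d where "d = (c - common_entropy) / (2 * m + 3)"
  have d: "0 < d" using c m by (simp add: d_def)
  have valid: "sk_valid V source_law n (S n)" for n using S by (simp add: sk_admissible_def)
  have ev_rate: "eventually (\<lambda>n. c < sk_key_rate b n (S n)) sequentially"
    using less_LiminfD[OF c(2)] by simp
  have ev_leak: "eventually (\<lambda>n. sk_leakage_rate b n (S n) < d) sequentially"
    using Limsup_lessD[of sequentially "\<lambda>n. ereal (sk_leakage_rate b n (S n))" "ereal d"] S d
    by (simp add: sk_admissible_def)
  have ev_disc: "eventually (\<lambda>n. sk_discussion_rate b n (S n) < d) sequentially"
    using Limsup_lessD[of sequentially "\<lambda>n. ereal (sk_discussion_rate b n (S n))" "ereal d"] S d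
    by (simp add: sk_admissible_def) (metis (no_types, lifting) ereal_less(2) order_le_less_trans zero_ereal_def)
  have err: "(\<lambda>n. sk_error V n (S n)) \<longlonglongrightarrow> 0" using S by (simp add: sk_admissible_def)
  have "(\<lambda>n. c * (1 - m * sk_error V n (S n))) \<longlonglongrightarrow> c * (1 - m * 0)"
    by (intro tendsto_intros err)
  then have ev_c: "eventually (\<lambda>n. c - d < c * (1 - m * sk_error V n (S n))) sequentially"
    using d by (intro order_tendstoD(1)) auto
  have "(\<lambda>n. 1 - m * sk_error V n (S n)) \<longlonglongrightarrow> 1 - m * 0"
    by (intro tendsto_intros err)
  then have ev_pos: "eventually (\<lambda>n. 0 < 1 - m * sk_error V n (S n)) sequentially"
    by (intro order_tendstoD(1)) auto
  have "(\<lambda>n. m * log b 2 / real n) \<longlonglongrightarrow> 0"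
    by (intro tendsto_divide_0[OF tendsto_const] filterlim_at_top_imp_at_infinity filterlim_real_sequentially)
  then have ev_const: "eventually (\<lambda>n. m * log b 2 / real n < d) sequentially"
    using d by (intro order_tendstoD(2))
  have "eventually (\<lambda>n. False) sequentially"
    using ev_rate ev_leak ev_disc ev_c ev_pos ev_const eventually_gt_at_top[of 0]
  proof eventually_elim
    case (elim n)
    let ?L = "log b (card (sk_K_alphabet (S n)))" and ?\<epsilon> = "sk_error V n (S n)"
      and ?h = "rv_cond_entropy b (measure_pmf (sk_joint (S n))) sk_key (sk_discussion n (S n))"
      and ?f = "log b (card (sk_F_alphabet (S n)))"
    have "?h \<le> n * common_entropy + m * (log b 2 + ?\<epsilon> * ?L) + 2 * (m - 1) * ?f"
      unfolding m_def by (rule key_entropy_le[OF valid])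
    \<comment> \<open>The Fano term contains the key length itself, so it moves to the left; the
      factor \<open>1 - m * ?\<epsilon>\<close> is eventually positive and tends to 1.\<close>
    then have "?L * (1 - m * ?\<epsilon>) \<le> n * common_entropy + m * log b 2 + 2 * (m - 1) * ?f + (?L - ?h)"
      by (simp add: algebra_simps)
    then have "?L * (1 - m * ?\<epsilon>) / n \<le> (n * common_entropy + m * log b 2 + 2 * (m - 1) * ?f + (?L - ?h)) / n"
      by (rule divide_right_mono) simp
    then have "sk_key_rate b n (S n) * (1 - m * ?\<epsilon>) \<le> common_entropy + m * log b 2 / n
        + 2 * (m - 1) * sk_discussion_rate b n (S n) + sk_leakage_rate b n (S n)"
      using elim(7) by (simp add: sk_key_rate_def sk_discussion_rate_def sk_leakage_rate_def add_divide_distrib)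
    moreover have "2 * (m - 1) * sk_discussion_rate b n (S n) \<le> 2 * (m - 1) * d"
      using elim(3) m by (intro mult_left_mono) auto
    moreover have "c * (1 - m * ?\<epsilon>) \<le> sk_key_rate b n (S n) * (1 - m * ?\<epsilon>)"
      using elim(1,5) by (intro mult_right_mono) auto
    ultimately have "c - d < common_entropy + d + 2 * (m - 1) * d + d"
      using elim(2,4,6) by linarith
    moreover have "c - common_entropy = (2 * m + 3) * d" using m by (simp add: d_def)
    ultimately have "(2 * m + 3) * d < (2 * m + 1) * d" by (simp add: algebra_simps)
    then show False using d by (simp add: algebra_simps)
  qed
  then show False by simp
qed

end

section \<open>Achievability\<close>

text \<open>Hoeffding's inequality for the information contents of \<open>n\<close> independent
  symbols: each lies in \<open>[0, B]\<close> and has mean \<open>pmf_entropy b p\<close>, so the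
  squared ranges add up to \<open>n * B^2\<close>.\<close>

lemma prob_information_content_deviation_le:
  fixes n :: nat and B :: real
  assumes b: "1 < b" and fin: "finite (set_pmf p)" and n: "0 < n" and \<epsilon>: "0 \<le> \<epsilon>"
    and B: "0 < B" "\<And>x. x \<in> set_pmf p \<Longrightarrow> - log b (pmf p x) \<le> B"
  shows "measure_pmf.prob (Pi_pmf {..<n} d (\<lambda>_. p))
      {x. \<epsilon> \<le> \<bar>(\<Sum>t<n. - log b (pmf p (x t))) - n * pmf_entropy b p\<bar>}
    \<le> 2 * exp (- 2 * \<epsilon>\<^sup>2 / (n * B\<^sup>2))"
proof -
  let ?P = "Pi_pmf {..<n} d (\<lambda>_. p)"
  interpret indep_interval_bounded_random_variables "measure_pmf ?P" "{..<n}"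
    "\<lambda>t x. - log b (pmf p (x t))" "\<lambda>_. 0" "\<lambda>_. B"
  proof
    show "prob_space.indep_vars ?P (\<lambda>_. borel) (\<lambda>t x. - log b (pmf p (x t))) {..<n}"
      by (rule prob_space.indep_vars_compose2[OF measure_pmf.prob_space_axioms indep_vars_Pi_pmf]) auto
    show "AE x in ?P. - log b (pmf p (x t)) \<in> {0..B}" if "t \<in> {..<n}" for t
      using that B(2) neg_log_pmf_nonneg[OF b, of p]
      by (auto simp: AE_measure_pmf_iff set_Pi_pmf PiE_dflt_def)
  qed simp
  interpret Hoeffding_ineq "measure_pmf ?P" "{..<n}"
    "\<lambda>t x. - log b (pmf p (x t))" "\<lambda>_. 0" "\<lambda>_. B"
    "\<Sum>t\<in>{..<n}. measure_pmf.expectation ?P (\<lambda>x. - log b (pmf p (x t)))"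
    by unfold_locales
  have "measure_pmf.expectation ?P (\<lambda>x. - log b (pmf p (x t))) = pmf_entropy b p" if "t < n" for t
  proof -
    have p: "p = map_pmf (\<lambda>x. x t) ?P" using that by (simp add: Pi_pmf_component)
    show ?thesis by (rule pmf_entropy_map[of b "\<lambda>x. x t" ?P, unfolded p[symmetric], symmetric])
  qed
  then have "(\<Sum>t\<in>{..<n}. measure_pmf.expectation ?P (\<lambda>x. - log b (pmf p (x t)))) = n * pmf_entropy b p"
    by simp
  then show ?thesis
    using Hoeffding_ineq_abs_ge[OF \<epsilon>] n B(1) by simp
qed

text \<open>The width of the typical set in the proof is \<open>n powr (3 / 4)\<close>: sublinear, but large enough for
  the bound above to tend to \<open>0\<close>.\<close>

lemma obtain_source_code:
  fixes p :: "'g pmf"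
  assumes b: "1 < b" and fin: "finite (set_pmf p)"
  obtains \<kappa> :: "nat \<Rightarrow> (nat \<Rightarrow> 'g) \<Rightarrow> nat" and N :: "nat \<Rightarrow> nat"
  where "\<And>n x. \<kappa> n x < N n"
    and "(\<lambda>n. log b (N n) / n) \<longlonglongrightarrow> pmf_entropy b p"
    and "(\<lambda>n. pmf_entropy b (map_pmf (\<kappa> n) (Pi_pmf {..<n} d (\<lambda>_. p))) / n) \<longlonglongrightarrow> pmf_entropy b p"
proof -
  define H where "H = pmf_entropy b p"
  define P where "P = (\<lambda>n :: nat. Pi_pmf {..<n} d (\<lambda>_. p))"
  define \<delta> where "\<delta> = (\<lambda>n. 1 / sqrt (sqrt (real n)))"
  define T where "T = (\<lambda>n :: nat. {x \<in> set_pmf (P n). \<bar>- log b (pmf (P n) x) - n * H\<bar> < n * \<delta> n})"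
  \<comment> \<open>Typical blocks are numbered from 1 and all others share the index 0, hence the
    successor in \<open>N\<close>.\<close>
  define \<kappa> where "\<kappa> = (\<lambda>n x. if x \<in> T n then Suc (to_nat_on (T n) x) else 0)"
  define N where "N = (\<lambda>n. Suc (card (T n)))"
  have H: "0 \<le> H" unfolding H_def by (rule pmf_entropy_nonneg[OF b])
  have \<delta>: "0 \<le> \<delta> n" for n by (simp add: \<delta>_def)
  have fin_P: "finite (set_pmf (P n))" for n
    unfolding P_def using fin by (intro finite_set_Pi_pmf) auto
  have fin_T: "finite (T n)" for n
    using fin_P by (simp add: T_def)
  have bij: "bij_betw (to_nat_on (T n)) (T n) {..<card (T n)}" for n
    by (rule to_nat_on_finite[OF fin_T])
  have \<kappa>_less: "\<kappa> n x < N n" for n x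
    using bij_betwE[OF bij[of n]] by (auto simp: \<kappa>_def N_def)

  have log_P: "- log b (pmf (P n) x) = (\<Sum>t<n. - log b (pmf p (x t)))" if "x \<in> set_pmf (P n)" for n x
  proof -
    have x: "\<forall>t. t \<notin> {..<n} \<longrightarrow> x t = d" "\<And>t. t < n \<Longrightarrow> 0 < pmf p (x t)"
      using that by (auto simp: P_def set_Pi_pmf PiE_dflt_def pmf_positive_iff)
    then have "pmf (P n) x = (\<Prod>t<n. pmf p (x t))" unfolding P_def by (subst pmf_Pi) auto
    moreover have "log b (\<Prod>t<n. pmf p (x t)) = (\<Sum>t<n. log b (pmf p (x t)))"
      unfolding log_def sum_divide_distrib[symmetric] using x(2) by (subst ln_prod) force+
    ultimately show ?thesis by (simp add: sum_negf)
  qed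

  obtain B where B: "0 < B" "\<And>x. x \<in> set_pmf p \<Longrightarrow> - log b (pmf p x) \<le> B"
  proof
    \<comment> \<open>The maximum with 1 below keeps the bound positive even when \<open>p\<close>
      is a point mass.\<close>
    let ?B = "Max ((\<lambda>x. - log b (pmf p x)) ` set_pmf p)"
    show "0 < max 1 ?B" by simp
    show "- log b (pmf p x) \<le> max 1 ?B" if "x \<in> set_pmf p" for x
      using that fin by (intro max.coboundedI2 Max_ge) auto
  qed
  have prob_T: "1 - 2 * exp (- (2 / B\<^sup>2 * sqrt n)) \<le> measure_pmf.prob (P n) (T n)" if n: "0 < n" for n
  proof -
    have "measure_pmf.prob (P n) (- T n) =
        measure_pmf.prob (P n) {x. n * \<delta> n \<le> \<bar>(\<Sum>t<n. - log b (pmf p (x t))) - n * H\<bar>}"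
      by (intro measure_pmf.finite_measure_eq_AE)
        (auto simp: AE_measure_pmf_iff T_def log_P not_less)
    also have "\<dots> \<le> 2 * exp (- 2 * (n * \<delta> n)\<^sup>2 / (n * B\<^sup>2))"
      unfolding P_def H_def using \<delta>[of n]
      by (intro prob_information_content_deviation_le[OF b fin n _ B]) auto
    \<comment> \<open>The squared width is \<open>n powr (3 / 2)\<close>, and dividing by
      \<open>n\<close> leaves \<open>sqrt n\<close>.\<close>
    also have "- 2 * (n * \<delta> n)\<^sup>2 / (n * B\<^sup>2) = - (2 / B\<^sup>2 * sqrt n)"
      using n B(1) by (simp add: \<delta>_def power_mult_distrib power_divide field_simps power2_eq_square)
    finally show ?thesis
      using measure_pmf.prob_compl[of "T n" "P n"] by (simp add: Compl_eq_Diff_UNIV)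
  qed
  have lim_sqrt: "filterlim (\<lambda>n. sqrt (real n)) at_top sequentially"
    by (rule filterlim_compose[OF sqrt_at_top filterlim_real_sequentially])
  have "(\<lambda>n. exp (- (2 / B\<^sup>2 * sqrt (real n)))) \<longlonglongrightarrow> 0"
    by (intro filterlim_compose[OF exp_at_bot] filterlim_compose[OF filterlim_uminus_at_bot_at_top]
        filterlim_tendsto_pos_mult_at_top[OF tendsto_const _ lim_sqrt]) (use B in auto)
  then have "(\<lambda>n. 1 - 2 * exp (- (2 / B\<^sup>2 * sqrt (real n)))) \<longlonglongrightarrow> 1 - 2 * 0"
    by (intro tendsto_intros)
  then have lim_exp: "(\<lambda>n. 1 - 2 * exp (- (2 / B\<^sup>2 * sqrt (real n)))) \<longlonglongrightarrow> 1" by simp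
  have lim_T: "(\<lambda>n. measure_pmf.prob (P n) (T n)) \<longlonglongrightarrow> 1"
  proof (rule tendsto_sandwich[OF _ _ lim_exp tendsto_const])
    show "eventually (\<lambda>n. 1 - 2 * exp (- (2 / B\<^sup>2 * sqrt (real n))) \<le> measure_pmf.prob (P n) (T n)) sequentially"
      using eventually_gt_at_top[of 0] by eventually_elim (rule prob_T)
  qed simp_all
  have lim_\<delta>: "\<delta> \<longlonglongrightarrow> 0"
    unfolding \<delta>_def
    by (rule tendsto_divide_0[OF tendsto_const
        filterlim_at_top_imp_at_infinity[OF filterlim_compose[OF sqrt_at_top lim_sqrt]]])

  \<comment> \<open>Each typical block has mass at least
    \<open>b powr - (n * (H + \<delta> n))\<close>, so there are at most as many as the reciprocal;
    the extra index 0 is absorbed by the factor 2.\<close>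
  have N_le: "log b (N n) \<le> log b 2 + n * (H + \<delta> n)" for n
  proof -
    have "card (T n) * b powr - (n * (H + \<delta> n)) \<le> (\<Sum>x\<in>T n. pmf (P n) x)"
    proof (rule sum_bounded_below)
      fix x assume x: "x \<in> T n"
      then have pos: "0 < pmf (P n) x" by (simp add: T_def pmf_positive_iff)
      have "- (n * (H + \<delta> n)) \<le> log b (pmf (P n) x)"
        using x by (simp add: T_def algebra_simps abs_less_iff)
      then show "b powr - (n * (H + \<delta> n)) \<le> pmf (P n) x"
        using pos b by (simp add: le_log_iff)
    qed
    also have "\<dots> \<le> 1"
      using measure_measure_pmf_finite[OF fin_T, of "P n" n] measure_pmf.prob_le_1[of "P n" "T n"] by simp
    finally have "card (T n) \<le> b powr (n * (H + \<delta> n))"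
      unfolding powr_minus inverse_eq_divide using b by (simp add: pos_divide_le_eq)
    moreover have "1 \<le> b powr (n * (H + \<delta> n))"
      using b H \<delta>[of n] by (intro ge_one_powr_ge_zero) auto
    ultimately have "real (N n) \<le> 2 * b powr (n * (H + \<delta> n))" by (simp add: N_def)
    then have "log b (N n) \<le> log b (2 * b powr (n * (H + \<delta> n)))"
      by (intro log_mono[OF b]) (auto simp: N_def)
    also have "\<dots> = log b 2 + n * (H + \<delta> n)" using b by (simp add: log_mult_pos)
    finally show ?thesis .
  qed
  have ent_le: "pmf_entropy b (map_pmf (\<kappa> n) (P n)) \<le> log b (N n)" for n
    using pmf_entropy_le_card[OF b, of "{..<N n}" "map_pmf (\<kappa> n) (P n)"] \<kappa>_less by (auto simp: image_subset_iff)
  \<comment> \<open>Typical blocks have an index of their own and hence keep their information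
    content, which exceeds \<open>n * (H - \<delta> n)\<close>; the other blocks contribute at least
    0.\<close>
  have ent_ge: "measure_pmf.prob (P n) (T n) * (n * (H - \<delta> n)) \<le> pmf_entropy b (map_pmf (\<kappa> n) (P n))" for n
  proof -
    have "indicator (T n) x * (n * (H - \<delta> n)) \<le> - log b (pmf (map_pmf (\<kappa> n) (P n)) (\<kappa> n x))" for x
    proof (cases "x \<in> T n")
      case True
      have "y = x" if "\<kappa> n y = \<kappa> n x" for y
      proof -
        have "y \<in> T n" using that True by (simp add: \<kappa>_def split: if_splits)
        moreover from this have "to_nat_on (T n) y = to_nat_on (T n) x"
          using that True by (simp add: \<kappa>_def)
        ultimately show ?thesis
          using inj_onD[OF bij_betw_imp_inj_on[OF bij[of n]]] True by blast
      qed
      then have "\<kappa> n -` {\<kappa> n x} = {x}" by blast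
      then have "pmf (map_pmf (\<kappa> n) (P n)) (\<kappa> n x) = pmf (P n) x"
        by (simp add: pmf_map measure_pmf_single)
      then show ?thesis using True by (simp add: T_def algebra_simps abs_less_iff)
    next
      case False
      then show ?thesis using neg_log_pmf_nonneg[OF b] by simp
    qed
    then have "measure_pmf.expectation (P n) (\<lambda>x. indicator (T n) x * (n * (H - \<delta> n))) \<le>
        measure_pmf.expectation (P n) (\<lambda>x. - log b (pmf (map_pmf (\<kappa> n) (P n)) (\<kappa> n x)))"
      by (intro integral_mono integrable_measure_pmf_finite fin_P)
    then show ?thesis unfolding pmf_entropy_map by simp
  qed

  have upper: "(\<lambda>n. log b 2 / n + (H + \<delta> n)) \<longlonglongrightarrow> 0 + (H + 0)"
    by (intro tendsto_intros lim_\<delta> tendsto_divide_0[OF tendsto_const] filterlim_at_top_imp_at_infinity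
        filterlim_real_sequentially)
  have lower: "(\<lambda>n. measure_pmf.prob (P n) (T n) * (H - \<delta> n)) \<longlonglongrightarrow> 1 * (H - 0)"
    by (intro tendsto_intros lim_T lim_\<delta>)
  \<comment> \<open>One chain squeezes both sequences to \<open>H\<close>, so the index is uniform
    up to a vanishing rate; this is what makes the leakage vanish later.\<close>
  have le: "measure_pmf.prob (P n) (T n) * (H - \<delta> n) \<le> pmf_entropy b (map_pmf (\<kappa> n) (P n)) / n"
    "pmf_entropy b (map_pmf (\<kappa> n) (P n)) / n \<le> log b (N n) / n"
    "log b (N n) / n \<le> log b 2 / n + (H + \<delta> n)" if "0 < n" for n
    using that ent_ge[of n] ent_le[of n] N_le[of n] by (auto simp: field_simps)
  have ev: "eventually (\<lambda>n. 0 < n) sequentially" by (rule eventually_gt_at_top)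
  show ?thesis
  proof (rule that[of \<kappa> N, OF \<kappa>_less])
    have "(\<lambda>n. log b (N n) / n) \<longlonglongrightarrow> H"
    proof (rule tendsto_sandwich[OF _ _ lower[simplified] upper[simplified]])
      show "eventually (\<lambda>n. measure_pmf.prob (P n) (T n) * (H - \<delta> n) \<le> log b (N n) / n) sequentially"
        using ev by eventually_elim (rule order.trans[OF le(1) le(2)])
      show "eventually (\<lambda>n. log b (N n) / n \<le> log b 2 / n + (H + \<delta> n)) sequentially"
        using ev by eventually_elim (rule le(3))
    qed
    then show "(\<lambda>n. log b (N n) / n) \<longlonglongrightarrow> pmf_entropy b p" by (simp add: H_def)
    have "(\<lambda>n. pmf_entropy b (map_pmf (\<kappa> n) (P n)) / n) \<longlonglongrightarrow> H"
    proof (rule tendsto_sandwich[OF _ _ lower[simplified] upper[simplified]])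
      show "eventually (\<lambda>n. measure_pmf.prob (P n) (T n) * (H - \<delta> n) \<le> pmf_entropy b (map_pmf (\<kappa> n) (P n)) / n) sequentially"
        using ev by eventually_elim (rule le(1))
      show "eventually (\<lambda>n. pmf_entropy b (map_pmf (\<kappa> n) (P n)) / n \<le> log b 2 / n + (H + \<delta> n)) sequentially"
        using ev by eventually_elim (rule order.trans[OF le(2) le(3)])
    qed
    then show "(\<lambda>n. pmf_entropy b (map_pmf (\<kappa> n) (Pi_pmf {..<n} d (\<lambda>_. p))) / n) \<longlonglongrightarrow> pmf_entropy b p"
      by (simp add: H_def P_def)
  qed
qed

context sk_source
begin

text \<open>All users apply the same index map to the same block of common edges. Atypical blocks
  are no exception, since everybody then outputs 0, so the error is exactly zero without any
  discussion, and only the leakage is asymptotic.\<close>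

lemma exists_scheme:
  "\<exists>S. sk_admissible b V source_law 0 S \<and> liminf (\<lambda>n. ereal (sk_key_rate b n (S n))) = ereal common_entropy"
proof -
  obtain Y \<alpha> \<gamma> where Y: "map_pmf Y source_law = Pi_pmf E undefined edge_law"
    and \<alpha>: "\<And>z i. z \<in> set_pmf source_law \<Longrightarrow> i \<in> V \<Longrightarrow> restrict (Y z) (edges_at i) = \<alpha> i (z i)"
    by (rule obtain_edge_values) (rule that; assumption)
  define g where "g = (\<lambda>z. restrict (Y z) full_edges)"
  \<comment> \<open>The source default maps to \<open>d\<close>, so a block of common edges has
    default \<open>d\<close> beyond \<open>n\<close>; the decoder below fills in the same
    value.\<close>
  define d where "d = g (\<lambda>_. undefined)"
  define pG where "pG = map_pmf g source_law"
  have "pG = map_pmf (\<lambda>f. restrict f full_edges) (map_pmf Y source_law)"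
    by (simp add: pG_def g_def pmf.map_comp comp_def)
  also have "\<dots> = Pi_pmf full_edges undefined edge_law"
    unfolding Y restrict_def using full_edges_subset(2) finite_E by (rule Pi_pmf_subset[symmetric, rotated])
  finally have pG: "pmf_entropy b pG = common_entropy"
    unfolding common_entropy_def using full_edges_subset(2) finite_E finite_edge_law
    by (auto intro!: pmf_entropy_Pi_pmf elim: finite_subset)
  have "finite (set_pmf pG)" unfolding pG_def using finite_source_law by simp
  then obtain \<kappa> :: "nat \<Rightarrow> (nat \<Rightarrow> 'e \<Rightarrow> 'x) \<Rightarrow> nat" and N :: "nat \<Rightarrow> nat"
    where \<kappa>: "\<And>n x. \<kappa> n x < N n"
    and N: "(\<lambda>n. log b (N n) / n) \<longlonglongrightarrow> common_entropy"
    and ent: "(\<lambda>n. pmf_entropy b (map_pmf (\<kappa> n) (Pi_pmf {..<n} d (\<lambda>_. pG))) / n) \<longlonglongrightarrow> common_entropy"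
    by (rule obtain_source_code[OF b, of pG d, unfolded pG]) (rule that; assumption)
  define Q where "Q = (\<lambda>n :: nat. pair_pmf (Pi_pmf V 0 (\<lambda>_. return_pmf (0 :: nat))) (Pi_pmf {..<n} (\<lambda>_. undefined) (\<lambda>_. source_law)))"
  define S :: "nat \<Rightarrow> 'z sk_scheme" where "S = (\<lambda>n. \<lparr>
    sk_private = \<lambda>_. return_pmf 0,
    sk_joint = map_pmf (\<lambda>(u, zs). (u, zs, \<kappa> n (g \<circ> zs))) (Q n),
    sk_rounds = 0, sk_speaker = \<lambda>_. 0, sk_message = \<lambda>_ _ _. 0,
    sk_F_alphabet = {[]}, sk_K_alphabet = {..<N n},
    sk_recover = \<lambda>i _ ob. \<kappa> n (\<lambda>t. if t < n then restrict (\<alpha> i (snd ob ! t)) full_edges else d)\<rparr>)"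
  have disc: "sk_discussion n (S n) \<omega> = []" for n \<omega>
    by (simp add: sk_discussion_def S_def)
  have valid: "sk_valid V source_law n (S n)" for n
  proof -
    have "map_pmf (\<lambda>(u, zs, k). (u, zs)) (sk_joint (S n)) = Q n"
      by (simp add: S_def pmf.map_comp comp_def case_prod_unfold)
    moreover have "sk_rounds (S n) = 0" "sk_F_alphabet (S n) = {[]}" "sk_K_alphabet (S n) = {..<N n}"
      "sk_private (S n) = (\<lambda>_. return_pmf 0)"
      by (simp_all add: S_def)
    moreover have "sk_key \<omega> < N n" if "\<omega> \<in> set_pmf (sk_joint (S n))" for \<omega>
      using that \<kappa> by (auto simp: S_def sk_key_def)
    ultimately show ?thesis
      by (simp add: sk_valid_def disc Q_def)
  qed
  have error: "sk_error V n (S n) = 0" for n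
  proof -
    have "sk_key \<omega> = sk_recover (S n) i (sk_discussion n (S n) \<omega>) (sk_observation n \<omega> i)"
      if \<omega>: "\<omega> \<in> set_pmf (sk_joint (S n))" and i: "i \<in> V" for \<omega> i
    proof -
      obtain u zs where eq: "\<omega> = (u, zs, \<kappa> n (g \<circ> zs))" and uzs: "(u, zs) \<in> set_pmf (Q n)"
        using \<omega> by (auto simp: S_def)
      have zs: "zs t \<in> set_pmf source_law" if "t < n" for t
        using uzs that by (auto simp: Q_def set_Pi_pmf PiE_dflt_def)
      have zs': "zs t = (\<lambda>_. undefined)" if "\<not> t < n" for t
        using uzs that by (auto simp: Q_def set_Pi_pmf PiE_dflt_def)
      \<comment> \<open>The common edges are among those at \<open>i\<close>, so \<alpha> applied to
        this user's symbol already determines them.\<close>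
      have "g (zs t) = restrict (\<alpha> i (zs t i)) full_edges" if "t < n" for t
        unfolding \<alpha>[OF zs[OF that] i, symmetric]
        by (simp add: g_def Int_absorb1[OF full_edges_subset(1)[OF i]])
      then have "g \<circ> zs = (\<lambda>t. if t < n then restrict (\<alpha> i (zs t i)) full_edges else d)"
        by (auto simp: fun_eq_iff d_def zs')
      then show ?thesis
        by (simp add: eq sk_key_def sk_observation_def S_def cong: if_cong)
    qed
    then show ?thesis
      unfolding sk_error_def by (auto simp: measure_pmf_zero_iff)
  qed
  have key: "map_pmf sk_key (sk_joint (S n)) = map_pmf (\<kappa> n) (Pi_pmf {..<n} d (\<lambda>_. pG))" for n
  proof -
    have "map_pmf sk_key (sk_joint (S n)) = map_pmf (\<kappa> n) (map_pmf (\<lambda>zs. g \<circ> zs) (map_pmf snd (Q n)))"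
      by (simp add: S_def pmf.map_comp comp_def sk_key_def case_prod_unfold)
    also have "map_pmf (\<lambda>zs. g \<circ> zs) (map_pmf snd (Q n)) = Pi_pmf {..<n} d (\<lambda>_. pG)"
      by (simp add: Q_def map_snd_pair_pmf pG_def Pi_pmf_map[where f = g and dflt = "\<lambda>_. undefined"] d_def)
    finally show ?thesis .
  qed
  \<comment> \<open>The discussion is constant, so conditioning on it leaves the entropy of the
    index.\<close>
  have leak: "sk_leakage_rate b n (S n) = log b (N n) / n
      - pmf_entropy b (map_pmf (\<kappa> n) (Pi_pmf {..<n} d (\<lambda>_. pG))) / n" for n
  proof -
    let ?q = "sk_joint (S n)"
    have pair: "map_pmf (\<lambda>\<omega>. (sk_key \<omega>, sk_discussion n (S n) \<omega>)) ?q = map_pmf (\<lambda>k. (k, [] :: nat list)) (map_pmf sk_key ?q)"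
      by (simp add: disc pmf.map_comp comp_def)
    have "finite (set_pmf (map_pmf sk_key ?q))"
      by (rule finite_subset[of _ "{..<N n}"]) (use \<kappa> in \<open>auto simp: key\<close>)
    then have "finite (set_pmf (map_pmf (\<lambda>\<omega>. (sk_key \<omega>, sk_discussion n (S n) \<omega>)) ?q))"
      unfolding pair by simp
    then have "rv_cond_entropy b (measure_pmf ?q) sk_key (sk_discussion n (S n)) =
        pmf_entropy b (map_pmf (\<lambda>k. (k, [] :: nat list)) (map_pmf sk_key ?q)) - pmf_entropy b (map_pmf (sk_discussion n (S n)) ?q)"
      unfolding pair[symmetric] by (rule rv_cond_entropy_measure_pmf[OF b])
    also have "pmf_entropy b (map_pmf (\<lambda>k. (k, [] :: nat list)) (map_pmf sk_key ?q)) = pmf_entropy b (map_pmf sk_key ?q)"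
      by (rule pmf_entropy_map_inj) (simp add: inj_on_def)
    also have "pmf_entropy b (map_pmf (sk_discussion n (S n)) ?q) = 0"
      by (simp add: disc[abs_def] pmf_entropy_def)
    finally show ?thesis
      unfolding key by (simp add: sk_leakage_rate_def S_def diff_divide_distrib)
  qed
  have "(\<lambda>n. sk_leakage_rate b n (S n)) \<longlonglongrightarrow> common_entropy - common_entropy"
    unfolding leak by (intro tendsto_diff N ent)
  then have "limsup (\<lambda>n. ereal (sk_leakage_rate b n (S n))) = ereal 0"
    by (intro lim_imp_Limsup) (auto intro: tendsto_ereal)
  moreover have "limsup (\<lambda>n. ereal (sk_discussion_rate b n (S n))) \<le> ereal 0"
    by (simp add: sk_discussion_rate_def S_def Limsup_const)
  ultimately have "sk_admissible b V source_law 0 S"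
    by (simp add: sk_admissible_def valid error)
  moreover have "liminf (\<lambda>n. ereal (sk_key_rate b n (S n))) = ereal common_entropy"
    using N by (intro lim_imp_Liminf) (auto simp: sk_key_rate_def S_def intro: tendsto_ereal)
  ultimately show ?thesis by blast
qed

lemma secrecy_capacity_eq: "secrecy_capacity b M V Z 0 = ereal common_entropy"
  unfolding secrecy_capacity_def source_law_def[symmetric]
proof (rule antisym)
  show "(SUP S\<in>{S. sk_admissible b V source_law 0 S}. liminf (\<lambda>n. ereal (sk_key_rate b n (S n)))) \<le> ereal common_entropy"
    by (rule SUP_least) (auto intro: liminf_key_rate_le)
  obtain S where "sk_admissible b V source_law 0 S"
    "liminf (\<lambda>n. ereal (sk_key_rate b n (S n))) = ereal common_entropy"
    using exists_scheme by blast
  then show "ereal common_entropy \<le> (SUP S\<in>{S. sk_admissible b V source_law 0 S}. liminf (\<lambda>n. ereal (sk_key_rate b n (S n))))"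
    by (intro SUP_upper2[of S]) auto
qed

lemma entropy_full_edges: "rv_entropy b M (rv_tuple full_edges X) = common_entropy"
  by (simp add: rv_entropy_eq_pmf_entropy[OF b] simple_X_tuple[OF full_edges_subset(2)]
      entropy_X_tuple[OF full_edges_subset(2)] common_entropy_def)

end

text \<open>Optimality of \<open>G\<close> is asserted against competitors of an arbitrary type,
  beyond the \<open>nat\<close>-valued ones over which \<open>J_GK\<close> ranges.\<close>

theorem theorem1:
  fixes M :: "'a measure" and b :: real and m :: nat and V :: "nat set"
    and Z :: "nat \<Rightarrow> 'a \<Rightarrow> 'z"
    and E :: "'e set" and \<xi> :: "'e \<Rightarrow> nat set" and X :: "'e \<Rightarrow> 'a \<Rightarrow> 'x"
    and G :: "'a \<Rightarrow> 'e \<Rightarrow> 'x"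
  assumes "prob_space M" and "1 < b"
    and "2 \<le> m" and "V = {1..m}"
    and "\<forall>i\<in>V. simple_function M (Z i)"
    and "hypergraphical b M V Z E \<xi> X"
    and "G = rv_tuple {e\<in>E. \<xi> e = V} X"
  shows "secrecy_capacity b M V Z 0 = ereal (J_GK b M V Z) \<and>
    gk_feasible b M V Z G \<and>
    (\<forall>G' :: 'a \<Rightarrow> 'g. gk_feasible b M V Z G' \<longrightarrow> rv_entropy b M G' \<le> rv_entropy b M G) \<and>
    rv_entropy b M G = J_GK b M V Z"
proof -
  interpret prob_space M by fact
  interpret sk_source M b V Z E \<xi> X
    using assms by unfold_locales auto
  have G: "G = rv_tuple full_edges X" using assms(7) by (simp add: full_edges_def)
  show ?thesis
    unfolding G J_GK_eq secrecy_capacity_eq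
    by (simp add: gk_feasible_full_edges gk_feasible_le[simplified entropy_full_edges] entropy_full_edges)
qed

end
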